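(* The following hold. (i) If $(C_1^>)_{(+,+)}\ne\emptyset$, then $(C_1^>)_{(+,+)}$ is asymptotic to the lines $\{\alpha_1^>\}\times\mathbb{R}$ and $\mathbb{R}\times\{\beta_1^>\}$. (ii) If $(C_1^>)_{(-,-)}\ne\emptyset$, then $(C_1^>)_{(-,-)}$ is asymptotic to the lines $\{\alpha_2^<\}\times\mathbb{R}$ and $\mathbb{R}\times\{\beta_2^<\}$. (iii) If $(C_1^>)_{(+,-)}\ne\emptyset$, then $(C_1^>)_{(+,-)}$ is asymptotic to the lines $\{\alpha_2^>\}\times\mathbb{R}$ and $\mathbb{R}\times\{\beta_1^<\}$. (iv) If $(C_1^>)_{(-,+)}\ne\emptyset$, then $(C_1^>)_{(-,+)}$ is asymptotic to the lines $\{\alpha_1^<\}\times\mathbb{R}$ and $\mathbb{R}\times\{\beta_2^>\}$. (i)' If $(C_1^<)_{(+,+)}\ne\emptyset$, then $(C_1^<)_{(+,+)}$ is asymptotic to the lines $\{\beta_1^>\}\times\mathbb{R}$ and $\mathbb{R}\times\{\alpha_1^>\}$. (ii)' If $(C_1^<)_{(-,-)}\ne\emptyset$, then $(C_1^<)_{(-,-)}$ is asymptotic to the lines $\{\beta_2^<\}\times\mathbb{R}$ and $\mathbb{R}\times\{\alpha_2^<\}$. (iii)' If $(C_1^<)_{(+,-)}\ne\emptyset$, then $(C_1^<)_{(+,-)}$ is asymptotic to the lines $\{\beta_2^>\}\times\mathbb{R}$ and $\mathbb{R}\times\{\alpha_1^<\}$. (iv)' If $(C_1^<)_{(-,+)}\ne\emptyset$,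 then $(C_1^<)_{(-,+)}$ is asymptotic to the lines $\{\beta_1^<\}\times\mathbb{R}$ and $\mathbb{R}\times\{\alpha_2^>\}$.
   Context: Let $T_1<T_2$ be real numbers, $p,q,m\in C[T_1,T_2]$ with $p(t)>0$ and $q(t)\ge 0$ on $[T_1,T_2]$, $m\not\equiv 0$, and $Lu:=-[p(t)u']'+q(t)u$. For a function $w$, write $w^\pm:=\max\{\pm w,0\}$; $\mathbb{R}_+=[0,+\infty[$, $\mathbb{R}_-=\,]-\infty,0]$. Consider $$Lu=m(t)[au^+-bu^-]\ \text{in } ]T_1,T_2[,\qquad u'(T_1)=0=u'(T_2).\qquad(P)$$ $C_1^>$ (resp. $C_1^<$) is the set of $(a,b)\in\mathbb{R}^2$ such that $(P)$ has a nontrivial solution with exactly one zero in $]T_1,T_2[$ and with $u(T_2)>0$ (resp. $u(T_2)<0$). For $\epsilon_1,\epsilon_2\in\{+,-\}$, $(C_1^>)_{(\epsilon_1,\epsilon_2)}:=C_1^>\cap(\mathbb{R}_{\epsilon_1}\times\mathbb{R}_{\epsilon_2})$ and $(C_1^<)_{(\epsilon_1,\epsilon_2)}:=C_1^<\cap(\mathbb{R}_{\epsilon_1}\times\mathbb{R}_{\epsilon_2})$. Each nonempty such set is the graph $\{(a,f(a))\}$ of a strictly monotone $C^1$-diffeomorphism $f$ between two unbounded open intervals. It is asymptotic to the lines $\{c\}\times\mathbb{R}$ and $\mathbb{R}\times\{d\}$ if, along it, $a\to c$ as $|b|\to\infty$ and $b\to d$ as $|a|\to\infty$. Zero-functions.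 Extend $p,q,m$ continuously to $\mathbb{R}$ with $p_1\le p\le p_2$, $0\le q\le q_2$ for some constants $p_1>0,p_2,q_2$. For $a,s\in\mathbb{R}$ let $v(\cdot;a,s)$ be the solution of $Lv=am(t)v$ in $\mathbb{R}$ with $v(s)=1$, $v'(s)=0$. Set $\psi_1(a):=\min\{t>T_1:v(t;a,T_1)=0\}$ ($+\infty$ if there is no such zero) and $\psi_2(a):=\sup\{t<T_2:v(t;a,T_2)=0\}$ ($-\infty$ if there is no such zero). The values of $\psi_1,\psi_2$ that lie in $[T_1,T_2]$ do not depend on the extensions. When $m^+\not\equiv0$: $T_1^>:=\inf\{t\in\,]T_1,T_2[:m(t)>0\}$, $T_2^>:=\sup\{t\in\,]T_1,T_2[:m(t)>0\}$. When $m^-\not\equiv0$: $T_1^<:=\inf\{t\in\,]T_1,T_2[:m(t)<0\}$, $T_2^<:=\sup\{t\in\,]T_1,T_2[:m(t)<0\}$. The following reals are uniquely determined when they exist. If $m^+\not\equiv0$: $\alpha_1^>>0$ (resp. $\alpha_1^<<0$) is the positive (resp. negative) real with $\psi_2(\alpha_1^>)=T_1^>$ (resp. $\psi_2(\alpha_1^<)=T_1^>$); $\beta_1^>>0$ (resp. $\beta_1^<<0$) is the real with $\psi_1(\beta_1^>)=T_2^>$ (resp. $\psi_1(\beta_1^<)=T_2^>$). If $m^-\not\equiv0$: $\alpha_2^>>0$ (resp. $\alpha_2^<<0$) is the real with $\psi_2(\alpha_2^>)=T_1^<$ (resp. $\psi_2(\alpha_2^<)=T_1^<$); $\beta_2^>>0$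 (resp. $\beta_2^<<0$) is the real with $\psi_1(\beta_2^>)=T_2^<$ (resp. $\psi_1(\beta_2^<)=T_2^<$). Part of the assertion in each case is that the two constants involved exist. *)

theory Defs
  imports "HOL-Analysis.Analysis"
begin

(* u is a solution of  -(p u')' + q u = f(t, u)  in the open set S, with u' = du. *)
definition solves_SL ::
  "(real \<Rightarrow> real) \<Rightarrow> (real \<Rightarrow> real) \<Rightarrow> (real \<Rightarrow> real \<Rightarrow> real) \<Rightarrow> real set
     \<Rightarrow> (real \<Rightarrow> real) \<Rightarrow> (real \<Rightarrow> real) \<Rightarrow> bool" where
  "solves_SL p q f S u du \<longleftrightarrow>
     (\<forall>t\<in>S. (u has_real_derivative du t) (at t) \<and>
            ((\<lambda>s. p s * du s) has_real_derivative (q t * u t - f t (u t))) (at t))"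

(* The Neumann problem for Lu = m (a u^+ - b u^-); u is of class C^1 on the closed
   interval, with one-sided derivatives at the end points. *)
definition solves_P ::
  "(real \<Rightarrow> real) \<Rightarrow> (real \<Rightarrow> real) \<Rightarrow> (real \<Rightarrow> real) \<Rightarrow> real \<Rightarrow> real \<Rightarrow> real \<Rightarrow> real
     \<Rightarrow> (real \<Rightarrow> real) \<Rightarrow> bool" where
  "solves_P p q m T1 T2 a b u \<longleftrightarrow>
     (\<exists>du. (\<forall>t\<in>{T1..T2}. (u has_real_derivative du t) (at t within {T1..T2})) \<and>
           continuous_on {T1..T2} du \<and>
           solves_SL p q (\<lambda>t x. m t * (a * max x 0 - b * max (- x) 0)) {T1<..<T2} u du \<and>
           du T1 = 0 \<and> du T2 = 0)"

definition C1_gt ::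
  "(real \<Rightarrow> real) \<Rightarrow> (real \<Rightarrow> real) \<Rightarrow> (real \<Rightarrow> real) \<Rightarrow> real \<Rightarrow> real \<Rightarrow> (real \<times> real) set" where
  "C1_gt p q m T1 T2 =
     {(a, b). \<exists>u. solves_P p q m T1 T2 a b u \<and> (\<exists>t\<in>{T1..T2}. u t \<noteq> 0) \<and>
                  (\<exists>!t. t \<in> {T1<..<T2} \<and> u t = 0) \<and> u T2 > 0}"

definition C1_lt ::
  "(real \<Rightarrow> real) \<Rightarrow> (real \<Rightarrow> real) \<Rightarrow> (real \<Rightarrow> real) \<Rightarrow> real \<Rightarrow> real \<Rightarrow> (real \<times> real) set" where
  "C1_lt p q m T1 T2 =
     {(a, b). \<exists>u. solves_P p q m T1 T2 a b u \<and> (\<exists>t\<in>{T1..T2}. u t \<noteq> 0) \<and>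
                  (\<exists>!t. t \<in> {T1<..<T2} \<and> u t = 0) \<and> u T2 < 0}"

(* v( . ; a, s); here and below P, Q, M are coefficients on the whole real line. *)
definition sol_v ::
  "(real \<Rightarrow> real) \<Rightarrow> (real \<Rightarrow> real) \<Rightarrow> (real \<Rightarrow> real) \<Rightarrow> real \<Rightarrow> real \<Rightarrow> real \<Rightarrow> real" where
  "sol_v P Q M a s =
     (THE v. \<exists>dv. solves_SL P Q (\<lambda>t x. a * M t * x) UNIV v dv \<and> v s = 1 \<and> dv s = 0)"

(* Inf and Sup are taken in ereal, so they are \<infinity> and -\<infinity> when there is no zero. Otherwise
   they are attained: the zero set is closed and s is not a limit of zeros, as v(s) = 1. *)
definition psi1 ::
  "(real \<Rightarrow> real) \<Rightarrow> (real \<Rightarrow> real) \<Rightarrow> (real \<Rightarrow> real) \<Rightarrow> real \<Rightarrow> real \<Rightarrow> ereal" where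
  "psi1 P Q M T1 a = Inf (ereal ` {t. T1 < t \<and> sol_v P Q M a T1 t = 0})"

definition psi2 ::
  "(real \<Rightarrow> real) \<Rightarrow> (real \<Rightarrow> real) \<Rightarrow> (real \<Rightarrow> real) \<Rightarrow> real \<Rightarrow> real \<Rightarrow> ereal" where
  "psi2 P Q M T2 a = Sup (ereal ` {t. t < T2 \<and> sol_v P Q M a T2 t = 0})"

definition pos_set :: "(real \<Rightarrow> real) \<Rightarrow> real \<Rightarrow> real \<Rightarrow> real set" where
  "pos_set m T1 T2 = {t \<in> {T1<..<T2}. m t > 0}"

definition neg_set :: "(real \<Rightarrow> real) \<Rightarrow> real \<Rightarrow> real \<Rightarrow> real set" where
  "neg_set m T1 T2 = {t \<in> {T1<..<T2}. m t < 0}"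

(* The eight constants. Z = pos_set gives the index 1, Z = neg_set the index 2;
   I = {0<..} gives the superscript >, I = {..<0} the superscript <. *)
definition is_alpha ::
  "(real \<Rightarrow> real) \<Rightarrow> (real \<Rightarrow> real) \<Rightarrow> (real \<Rightarrow> real) \<Rightarrow> real \<Rightarrow> real set \<Rightarrow> real set \<Rightarrow> real \<Rightarrow> bool" where
  "is_alpha P Q M T2 Z I \<alpha> \<longleftrightarrow> Z \<noteq> {} \<and> \<alpha> \<in> I \<and> psi2 P Q M T2 \<alpha> = ereal (Inf Z)"

definition is_beta ::
  "(real \<Rightarrow> real) \<Rightarrow> (real \<Rightarrow> real) \<Rightarrow> (real \<Rightarrow> real) \<Rightarrow> real \<Rightarrow> real set \<Rightarrow> real set \<Rightarrow> real \<Rightarrow> bool" where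
  "is_beta P Q M T1 Z I \<beta> \<longleftrightarrow> Z \<noteq> {} \<and> \<beta> \<in> I \<and> psi1 P Q M T1 \<beta> = ereal (Sup Z)"

(* The filters of points of C whose first (second) coordinate tends to infinity in modulus.
   They are required to be proper, so that the two limits are not vacuous. *)
definition fst_to_infinity :: "(real \<times> real) set \<Rightarrow> (real \<times> real) filter" where
  "fst_to_infinity C = inf (filtercomap (\<lambda>z. \<bar>fst z\<bar>) at_top) (principal C)"

definition snd_to_infinity :: "(real \<times> real) set \<Rightarrow> (real \<times> real) filter" where
  "snd_to_infinity C = inf (filtercomap (\<lambda>z. \<bar>snd z\<bar>) at_top) (principal C)"

definition asymptotic_to_lines :: "(real \<times> real) set \<Rightarrow> real \<Rightarrow> real \<Rightarrow> bool" where
  "asymptotic_to_lines C c d \<longleftrightarrow>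
     snd_to_infinity C \<noteq> bot \<and> (fst \<longlongrightarrow> c) (snd_to_infinity C) \<and>
     fst_to_infinity C \<noteq> bot \<and> (snd \<longlongrightarrow> d) (fst_to_infinity C)"

(* As above, c and d being the reals determined by A and B, which are asserted to exist. *)
definition asymptotic_to_the_lines ::
  "(real \<times> real) set \<Rightarrow> (real \<Rightarrow> bool) \<Rightarrow> (real \<Rightarrow> bool) \<Rightarrow> bool" where
  "asymptotic_to_the_lines C A B \<longleftrightarrow>
     (\<exists>!c. A c) \<and> (\<exists>!d. B d) \<and> asymptotic_to_lines C (THE c. A c) (THE d. B d)"

end

theory Submission
  imports Defs
begin

text \<open>
  Cutting a solution at its zero \<open>\<tau>\<close>, the right part is a multiple of \<open>v(\<cdot>; a, T2)\<close> and the left part one of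
  \<open>v(\<cdot>; b, T1)\<close>; conversely two such pieces can be glued. So \<open>(a, b)\<close> lies on the curve iff
  \<open>psi2 a = psi1 b = \<tau>\<close> for some \<open>\<tau>\<close> in the open interval. A Picone identity shows that \<open>psi2\<close> is
  strictly increasing in \<open>a > 0\<close>, although \<open>M\<close> may change sign; it takes exactly the values below
  the supremum of the points where \<open>M > 0\<close> (continuous dependence on \<open>a\<close>, and oscillation for
  large \<open>a\<close>). Reflecting \<open>t\<close> and changing the sign of \<open>M\<close> give the analogues for \<open>psi1\<close> and for
  negative weights. On each quadrant \<open>\<tau>\<close> is then a monotone parameter running between an infimum
  and a supremum of sign sets, and one coordinate blows up at each end while the other one has
  the claimed limit.
\<close>

section \<open>The linear equation\<close>

text \<open>The limit of one coordinate is dictated by the sign of the other one, which explains the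
  mixed indices of the constants. In the quadrant with signs \<open>s1\<close>, \<open>s2\<close>
  the right piece can vanish at \<open>\<tau>\<close> only if \<open>s1 * m\<close> is positive
  somewhere to the right of \<open>\<tau>\<close>, and the left piece only if \<open>s2 * m\<close>
  is positive somewhere to its left. So \<open>\<tau>\<close> stays between \<open>i\<close>, the
  infimum of the set where \<open>s2 * m > 0\<close>, and \<open>j\<close>, the supremum of the set
  where \<open>s1 * m > 0\<close>. As \<open>\<tau>\<close> decreases to \<open>i\<close>, the left
  piece has ever less room to be bent down to zero and \<open>b\<close> blows up in modulus, whereas
  \<open>i < j\<close> leaves a finite \<open>a\<close> whose zero is exactly \<open>i\<close>: that
  is the limit of \<open>a\<close>. The obstacle is monotonicity: a larger \<open>a\<close> does not
  enlarge \<open>a * m\<close> where \<open>m < 0\<close>, so Sturm comparison of the coefficients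
  fails. What makes the scaled identity work is \<open>0 \<le> Q\<close>. Since \<open>P\<close> is
  merely continuous, \<open>u''\<close> need not exist, and every argument is phrased with the pair
  of \<open>u\<close> and its flux \<open>P u'\<close>.\<close>

lemma mono_of_deriv_nonneg:
  fixes f f' :: "real \<Rightarrow> real"
  assumes "continuous_on {c..d} f"
    and "\<And>t. c < t \<Longrightarrow> t < d \<Longrightarrow> (f has_real_derivative f' t) (at t)"
    and "\<And>t. c < t \<Longrightarrow> t < d \<Longrightarrow> 0 \<le> f' t"
    and "c \<le> x" "x \<le> y" "y \<le> d"
  shows "f x \<le> f y"
proof (rule DERIV_nonneg_imp_increasing_open[OF \<open>x \<le> y\<close>])
  show "continuous_on {x..y} f"
    using assms(1) by (rule continuous_on_subset) (use assms in auto)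
qed (use assms(2,3,4,6) in force)

text \<open>The bound makes \<open>E t * exp (- C * t)\<close> decreasing and
  \<open>E t * exp (C * t)\<close> increasing; the former gives the estimate to the right of
  \<open>s\<close>, the latter to the left. Both sides matter because solutions are normalised at
  either end of an interval.\<close>

lemma gronwall:
  fixes E E' :: "real \<Rightarrow> real"
  assumes cont: "continuous_on {c..d} E"
    and der: "\<And>t. c < t \<Longrightarrow> t < d \<Longrightarrow> (E has_real_derivative E' t) (at t)"
    and bound: "\<And>t. c < t \<Longrightarrow> t < d \<Longrightarrow> \<bar>E' t\<bar> \<le> C * E t"
    and st: "s \<in> {c..d}" "t \<in> {c..d}"
  shows "E t \<le> E s * exp (C * \<bar>t - s\<bar>)"
proof (cases "s \<le> t")
  case True
  have "- (E s * exp (- C * s)) \<le> - (E t * exp (- C * t))"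
  proof (rule mono_of_deriv_nonneg[where c = c and d = d
        and f = "\<lambda>t. - (E t * exp (- C * t))" and f' = "\<lambda>t. (C * E t - E' t) * exp (- C * t)"])
    show "continuous_on {c..d} (\<lambda>t. - (E t * exp (- C * t)))"
      by (intro continuous_intros cont)
    fix x assume x: "c < x" "x < d"
    show "((\<lambda>t. - (E t * exp (- C * t))) has_real_derivative (C * E x - E' x) * exp (- C * x)) (at x)"
      by (rule derivative_eq_intros der[OF x] refl)+ (simp add: algebra_simps)
    show "0 \<le> (C * E x - E' x) * exp (- C * x)"
      using bound[OF x] by (intro mult_nonneg_nonneg) auto
  qed (use st True in auto)
  then have "E t * exp (- C * t) * exp (C * t) \<le> E s * exp (- C * s) * exp (C * t)"
    by (intro mult_right_mono) auto
  then show ?thesis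
    using True by (simp add: mult.assoc flip: exp_add) (simp add: algebra_simps)
next
  case False
  have "E t * exp (C * t) \<le> E s * exp (C * s)"
  proof (rule mono_of_deriv_nonneg[where c = c and d = d
        and f = "\<lambda>t. E t * exp (C * t)" and f' = "\<lambda>t. (C * E t + E' t) * exp (C * t)"])
    show "continuous_on {c..d} (\<lambda>t. E t * exp (C * t))"
      by (intro continuous_intros cont)
    fix x assume x: "c < x" "x < d"
    show "((\<lambda>t. E t * exp (C * t)) has_real_derivative (C * E x + E' x) * exp (C * x)) (at x)"
      by (rule derivative_eq_intros der[OF x] refl)+ (simp add: algebra_simps)
    show "0 \<le> (C * E x + E' x) * exp (C * x)"
      using bound[OF x] by (intro mult_nonneg_nonneg) auto
  qed (use st False in auto)
  then have "E t * exp (C * t) * exp (- C * t) \<le> E s * exp (C * s) * exp (- C * t)"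
    by (intro mult_right_mono) auto
  then show ?thesis
    using False by (simp add: mult.assoc flip: exp_add) (simp add: algebra_simps)
qed

text \<open>
  The first-order system for \<open>(P u')' = R u + g\<close>, with \<open>w\<close> the flux \<open>P u'\<close>. The inhomogeneity \<open>g\<close>
  is only needed for the difference of two solutions with different weights.
\<close>

definition sl_pair ::
  "(real \<Rightarrow> real) \<Rightarrow> (real \<Rightarrow> real) \<Rightarrow> (real \<Rightarrow> real) \<Rightarrow> real \<Rightarrow> real
     \<Rightarrow> (real \<Rightarrow> real) \<Rightarrow> (real \<Rightarrow> real) \<Rightarrow> bool" where
  "sl_pair P R g c d u w \<longleftrightarrow> continuous_on {c..d} u \<and> continuous_on {c..d} w \<and>
     (\<forall>t\<in>{c<..<d}. (u has_real_derivative w t / P t) (at t) \<and>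
                   (w has_real_derivative R t * u t + g t) (at t))"

text \<open>Adding the constant \<open>k\<^sup>2\<close> to the energy absorbs the inhomogeneity, so
  the differential inequality stays homogeneous and Gronwall applies directly. In the rate,
  \<open>1 / p1 + r\<close> comes from the cross term in \<open>u\<close> and \<open>w\<close>, and
  the \<open>1\<close> from \<open>2 * \<bar>w x\<bar> * \<bar>g x\<bar> \<le> (w x)\<^sup>2 +
  k\<^sup>2\<close>.\<close>

lemma sl_pair_energy:
  assumes sl: "sl_pair P R g c d u w"
    and P: "\<And>t. p1 \<le> P t" "0 < p1"
    and R: "\<And>t. t \<in> {c..d} \<Longrightarrow> \<bar>R t\<bar> \<le> r" "0 \<le> r"
    and g: "\<And>t. t \<in> {c..d} \<Longrightarrow> \<bar>g t\<bar> \<le> k"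
    and st: "s \<in> {c..d}" "t \<in> {c..d}"
  shows "(u t)\<^sup>2 + (w t)\<^sup>2 + k\<^sup>2
    \<le> ((u s)\<^sup>2 + (w s)\<^sup>2 + k\<^sup>2) * exp ((1 / p1 + r + 1) * \<bar>t - s\<bar>)"
proof (rule gronwall[where c = c and d = d and E = "\<lambda>t. (u t)\<^sup>2 + (w t)\<^sup>2 + k\<^sup>2"
      and E' = "\<lambda>t. 2 * u t * (w t / P t) + 2 * w t * (R t * u t + g t)"])
  show "continuous_on {c..d} (\<lambda>t. (u t)\<^sup>2 + (w t)\<^sup>2 + k\<^sup>2)"
    using sl by (auto simp: sl_pair_def intro!: continuous_intros)
  fix x assume x: "c < x" "x < d"
  have du: "(u has_real_derivative w x / P x) (at x)"
    and dw: "(w has_real_derivative R x * u x + g x) (at x)"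
    using sl x by (auto simp: sl_pair_def)
  show "((\<lambda>t. (u t)\<^sup>2 + (w t)\<^sup>2 + k\<^sup>2) has_real_derivative
      2 * u x * (w x / P x) + 2 * w x * (R x * u x + g x)) (at x)"
    by (rule derivative_eq_intros du dw refl)+ simp
  have uw: "2 * \<bar>u x\<bar> * \<bar>w x\<bar> \<le> (u x)\<^sup>2 + (w x)\<^sup>2"
    using sum_squares_bound[of "\<bar>u x\<bar>" "\<bar>w x\<bar>"] by simp
  have kw: "2 * \<bar>w x\<bar> * \<bar>g x\<bar> \<le> (w x)\<^sup>2 + k\<^sup>2"
  proof -
    have "\<bar>g x\<bar> \<le> k"
      using g[of x] x by simp
    moreover from this have "(g x)\<^sup>2 \<le> k\<^sup>2"
      using abs_le_square_iff[of "g x" k] by auto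
    moreover have "2 * \<bar>w x\<bar> * \<bar>g x\<bar> \<le> (w x)\<^sup>2 + (g x)\<^sup>2"
      using sum_squares_bound[of "\<bar>w x\<bar>" "\<bar>g x\<bar>"] by simp
    ultimately show ?thesis
      by linarith
  qed
  have Px: "0 < P x"
    using P(1)[of x] P(2) by simp
  have R': "1 / P x + \<bar>R x\<bar> \<le> 1 / p1 + r"
    using R(1)[of x] P(1)[of x] P(2) x by (intro add_mono) (auto simp: frac_le)
  have "\<bar>2 * u x * (w x / P x) + 2 * w x * (R x * u x + g x)\<bar>
      = \<bar>2 * u x * w x * (1 / P x + R x) + 2 * w x * g x\<bar>"
    by (simp add: algebra_simps)
  also have "\<dots> \<le> 2 * \<bar>u x\<bar> * \<bar>w x\<bar> * \<bar>1 / P x + R x\<bar> + 2 * \<bar>w x\<bar> * \<bar>g x\<bar>"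
    by (rule order_trans[OF abs_triangle_ineq]) (simp add: abs_mult)
  also have "\<dots> \<le> ((u x)\<^sup>2 + (w x)\<^sup>2) * (1 / p1 + r) + ((w x)\<^sup>2 + k\<^sup>2)"
    by (intro add_mono mult_mono uw kw) (use R' Px abs_triangle_ineq[of "1 / P x" "R x"] in auto)
  also have "\<dots> \<le> (1 / p1 + r + 1) * ((u x)\<^sup>2 + (w x)\<^sup>2 + k\<^sup>2)"
    using P R by (simp add: algebra_simps add_nonneg_nonneg)
  finally show "\<bar>2 * u x * (w x / P x) + 2 * w x * (R x * u x + g x)\<bar>
      \<le> (1 / p1 + r + 1) * ((u x)\<^sup>2 + (w x)\<^sup>2 + k\<^sup>2)" .
qed (use st in auto)

section \<open>Uniqueness for the linear system\<close>

lemma continuous_bounded_on_interval: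
  fixes f :: "real \<Rightarrow> real"
  assumes "continuous_on {c..d} f"
  obtains B where "0 \<le> B" "\<And>t. t \<in> {c..d} \<Longrightarrow> \<bar>f t\<bar> \<le> B"
proof -
  have "bounded (f ` {c..d})"
    using assms by (intro compact_imp_bounded compact_continuous_image) auto
  then obtain B where "\<forall>t\<in>{c..d}. \<bar>f t\<bar> \<le> B"
    by (auto simp: bounded_iff)
  then show ?thesis
    by (intro that[of "max B 0"]) (auto simp: le_max_iff_disj)
qed

lemma sl_pair_zero:
  assumes sl: "sl_pair P R (\<lambda>_. 0) c d u w"
    and P: "\<And>t. p1 \<le> P t" "0 < p1"
    and R: "continuous_on {c..d} R"
    and s: "s \<in> {c..d}" "u s = 0" "w s = 0"
    and t: "t \<in> {c..d}"
  shows "u t = 0" "w t = 0"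
proof -
  obtain r where r: "0 \<le> r" "\<And>t. t \<in> {c..d} \<Longrightarrow> \<bar>R t\<bar> \<le> r"
    using continuous_bounded_on_interval[OF R] by blast
  have "(u t)\<^sup>2 + (w t)\<^sup>2 \<le> 0"
    using sl_pair_energy[OF sl P r(2) r(1) _ s(1) t, of 0] s by simp
  then have "u t = 0 \<and> w t = 0"
    by (simp add: sum_power2_le_zero_iff)
  then show "u t = 0" "w t = 0"
    by auto
qed

lemma sl_pair_lincomb:
  assumes "sl_pair P R g1 c d u1 w1" "sl_pair P R g2 c d u2 w2"
  shows "sl_pair P R (\<lambda>t. k1 * g1 t + k2 * g2 t) c d
    (\<lambda>t. k1 * u1 t + k2 * u2 t) (\<lambda>t. k1 * w1 t + k2 * w2 t)"
  unfolding sl_pair_def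
proof (intro conjI ballI)
  fix t assume "t \<in> {c<..<d}"
  then have d: "(u1 has_real_derivative w1 t / P t) (at t)" "(w1 has_real_derivative R t * u1 t + g1 t) (at t)"
    "(u2 has_real_derivative w2 t / P t) (at t)" "(w2 has_real_derivative R t * u2 t + g2 t) (at t)"
    using assms by (auto simp: sl_pair_def)
  show "((\<lambda>t. k1 * u1 t + k2 * u2 t) has_real_derivative (k1 * w1 t + k2 * w2 t) / P t) (at t)"
    by (rule derivative_eq_intros d refl)+ (simp add: add_divide_distrib algebra_simps)
  show "((\<lambda>t. k1 * w1 t + k2 * w2 t) has_real_derivative
      R t * (k1 * u1 t + k2 * u2 t) + (k1 * g1 t + k2 * g2 t)) (at t)"
    by (rule derivative_eq_intros d refl)+ (simp add: algebra_simps)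
qed (use assms in \<open>auto simp: sl_pair_def intro!: continuous_intros\<close>)

text \<open>The factor \<open>k\<close> lets one lemma serve both the uniqueness of normalised
  solutions (\<open>k = 1\<close>) and the identification of a piece of a Neumann solution with a
  multiple of a normalised one.\<close>

lemma sl_pair_unique:
  assumes sl: "sl_pair P R (\<lambda>_. 0) c d u1 w1" "sl_pair P R (\<lambda>_. 0) c d u2 w2"
    and P: "\<And>t. p1 \<le> P t" "0 < p1"
    and R: "continuous_on {c..d} R"
    and s: "s \<in> {c..d}" "u1 s = k * u2 s" "w1 s = k * w2 s"
    and t: "t \<in> {c..d}"
  shows "u1 t = k * u2 t" "w1 t = k * w2 t"
  using sl_pair_zero[OF sl_pair_lincomb[OF sl, of 1 "- k", simplified] P R s(1) _ _ t] s by auto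

section \<open>Global existence by the Picard series\<close>

lemma antiderivative_exists:
  fixes f :: "real \<Rightarrow> real"
  assumes "continuous_on UNIV f"
  shows "\<exists>F. F s = 0 \<and> (\<forall>t. (F has_real_derivative f t) (at t))"
proof -
  obtain F where F: "\<And>t. (F has_real_derivative f t) (at t)"
    using einterval_antiderivative[where a = "-\<infinity>" and b = \<infinity> and f = f] assms
    by (auto simp: continuous_on_eq_continuous_at has_real_derivative_iff_has_vector_derivative)
  have "((\<lambda>t. F t - F s) has_real_derivative f t) (at t)" for t
    by (rule derivative_eq_intros F refl)+ simp
  then show ?thesis
    by (intro exI[of _ "\<lambda>t. F t - F s"]) auto
qed

text \<open>One integration raises the power and the factorial together; iterated, this produces the
  terms of an exponential series. The monotone difference of bound and function stands in for the
  integral.\<close>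

lemma antiderivative_bound_right:
  fixes F f :: "real \<Rightarrow> real"
  assumes F: "F s = 0" "\<And>t. (F has_real_derivative f t) (at t)"
    and bound: "\<And>t. s \<le> t \<Longrightarrow> t \<le> s + N \<Longrightarrow> f t \<le> c * (t - s) ^ n / fact n"
    and t: "s \<le> t" "t \<le> s + N"
  shows "F t \<le> c * (t - s) ^ Suc n / fact (Suc n)"
proof -
  have "c * (s - s) ^ Suc n / fact (Suc n) - F s \<le> c * (t - s) ^ Suc n / fact (Suc n) - F t"
  proof (rule mono_of_deriv_nonneg[where c = s and d = "s + N"
        and f = "\<lambda>t. c * (t - s) ^ Suc n / fact (Suc n) - F t" and f' = "\<lambda>t. c * (t - s) ^ n / fact n - f t"])
    have "continuous_on {s..s + N} F"
      using F(2) by (meson DERIV_continuous_on DERIV_subset UNIV_I subset_UNIV)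
    then show "continuous_on {s..s + N} (\<lambda>t. c * (t - s) ^ Suc n / fact (Suc n) - F t)"
      by (intro continuous_intros) auto
    fix x assume "s < x" "x < s + N"
    have "(\<lambda>t. c * (t - s) ^ Suc n / fact (Suc n) - F t) = (\<lambda>t. (c / fact (Suc n)) * (t - s) ^ Suc n - F t)"
      by simp
    moreover have "((\<lambda>t. (c / fact (Suc n)) * (t - s) ^ Suc n - F t) has_real_derivative
        (c / fact (Suc n)) * (real (Suc n) * (x - s) ^ n) - f x) (at x)"
      by (rule derivative_eq_intros F refl)+ simp
    moreover have "(c / fact (Suc n)) * (real (Suc n) * (x - s) ^ n) = c * (x - s) ^ n / fact n"
      unfolding fact_Suc by (simp del: of_nat_Suc)
    ultimately show "((\<lambda>t. c * (t - s) ^ Suc n / fact (Suc n) - F t) has_real_derivative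
        c * (x - s) ^ n / fact n - f x) (at x)"
      by metis
  qed (use t bound in auto)
  then show ?thesis
    using F by simp
qed

lemma antiderivative_bound:
  fixes F f :: "real \<Rightarrow> real"
  assumes F: "F s = 0" "\<And>t. (F has_real_derivative f t) (at t)"
    and bound: "\<And>t. \<bar>t - s\<bar> \<le> N \<Longrightarrow> \<bar>f t\<bar> \<le> c * \<bar>t - s\<bar> ^ n / fact n"
    and t: "\<bar>t - s\<bar> \<le> N"
  shows "\<bar>F t\<bar> \<le> c * \<bar>t - s\<bar> ^ Suc n / fact (Suc n)"
proof (cases "s \<le> t")
  case True
  have b: "f x \<le> c * (x - s) ^ n / fact n" "- f x \<le> c * (x - s) ^ n / fact n"
    if "s \<le> x" "x \<le> s + N" for x
    using bound[of x] that by (auto simp: abs_le_iff)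
  have "F t \<le> c * (t - s) ^ Suc n / fact (Suc n)"
    by (rule antiderivative_bound_right[OF F b(1)]) (use t True in auto)
  moreover have "- F t \<le> c * (t - s) ^ Suc n / fact (Suc n)"
    by (rule antiderivative_bound_right[where F = "\<lambda>t. - F t" and f = "\<lambda>t. - f t", OF _ _ b(2)])
      (use t True F in \<open>auto intro!: DERIV_minus\<close>)
  ultimately show ?thesis
    using True by (simp add: abs_le_iff)
next
  case False
  \<comment> \<open>Reflection in \<open>s\<close> carries a point on the left to one on the right,
    where the one-sided bound applies.\<close>
  let ?G = "\<lambda>x. F (2 * s - x)" and ?t = "2 * s - t"
  have G: "((\<lambda>x. F (2 * s - x)) has_real_derivative - f (2 * s - x)) (at x)" for x
    by (rule DERIV_chain2[OF F(2), THEN DERIV_cong] derivative_eq_intros refl)+ simp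
  have b: "- f (2 * s - x) \<le> c * (x - s) ^ n / fact n" "f (2 * s - x) \<le> c * (x - s) ^ n / fact n"
    if "s \<le> x" "x \<le> s + N" for x
    using bound[of "2 * s - x"] that by (auto simp: abs_le_iff)
  have "?G ?t \<le> c * (?t - s) ^ Suc n / fact (Suc n)"
    by (rule antiderivative_bound_right[OF _ G b(1)]) (use t False F in auto)
  moreover have "- ?G ?t \<le> c * (?t - s) ^ Suc n / fact (Suc n)"
    by (rule antiderivative_bound_right[where F = "\<lambda>t. - F (2 * s - t)" and f = "\<lambda>t. f (2 * s - t)", OF _ _ b(2)])
      (use t False F G in \<open>auto intro!: DERIV_minus[THEN DERIV_cong]\<close>)
  ultimately show ?thesis
    using False by (simp add: abs_le_iff abs_if)
qed

lemma termwise_derivative: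
  fixes f f' :: "nat \<Rightarrow> real \<Rightarrow> real"
  assumes der: "\<And>n t. (f n has_real_derivative f' n t) (at t)"
    and f: "\<And>n t. \<bar>t - s\<bar> \<le> N \<Longrightarrow> \<bar>f n t\<bar> \<le> C * B ^ n / fact n"
    and f': "\<And>n t. \<bar>t - s\<bar> \<le> N \<Longrightarrow> \<bar>f' n t\<bar> \<le> C' * B ^ n / fact n"
    and t: "\<bar>t - s\<bar> < N"
  shows "summable (\<lambda>n. f n t)" "summable (\<lambda>n. f' n t)"
    "((\<lambda>t. \<Sum>n. f n t) has_real_derivative (\<Sum>n. f' n t)) (at t)"
proof -
  have ex: "summable (\<lambda>n. K * B ^ n / fact n)" for K
    using summable_mult[OF summable_exp[of B], of K] by (simp add: field_simps)
  have I: "x \<in> {s - N..s + N} \<longleftrightarrow> \<bar>x - s\<bar> \<le> N" for x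
    by auto
  show sf: "summable (\<lambda>n. f n t)"
    by (rule summable_comparison_test'[OF ex[of C], of 0]) (use f t in auto)
  show "summable (\<lambda>n. f' n t)"
    by (rule summable_comparison_test'[OF ex[of C'], of 0]) (use f' t in auto)
  have u: "uniformly_convergent_on {s - N..s + N} (\<lambda>n x. \<Sum>i<n. f' i x)"
    using f' I by (intro Weierstrass_m_test'[OF _ ex[of C']]) auto
  show "((\<lambda>t. \<Sum>n. f n t) has_real_derivative (\<Sum>n. f' n t)) (at t)"
    by (rule has_field_derivative_series'(2)[of "{s - N..s + N}" f f' t, OF _ _ u])
      (use der sf t I in \<open>auto intro: has_field_derivative_at_within\<close>)
qed

text \<open>The Picard corrections to the initial value are summed. Their factorial bounds hold on
  every bounded interval about \<open>s\<close>, so the series solves the system on the whole line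
  at once, without a continuation argument.\<close>

lemma sl_exists:
  fixes P R :: "real \<Rightarrow> real"
  assumes P: "continuous_on UNIV P" "\<And>t. p1 \<le> P t" "0 < p1"
    and R: "continuous_on UNIV R"
  shows "\<exists>u w. u s = 1 \<and> w s = 0 \<and> (\<forall>t. (u has_real_derivative w t / P t) (at t) \<and>
    (w has_real_derivative R t * u t) (at t))"
proof -
  have P0: "P t > 0" for t
    using P(2)[of t] P(3) by simp
  have divP: "\<bar>y / P x\<bar> \<le> k / p1" if "\<bar>y\<bar> \<le> k" for x y k
    using frac_le[OF _ that P(3) P(2)[of x]] that P0[of x] by (simp add: abs_divide)
  \<comment> \<open>\<open>J\<close> is integration from \<open>s\<close>: a chosen antiderivative
    that vanishes there. \<open>U n\<close> and \<open>W n\<close> are then the successive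
    corrections to the value and to the flux.\<close>
  define J where "J f = (SOME F. F s = 0 \<and> (\<forall>t. (F has_real_derivative f t) (at t)))"
    for f :: "real \<Rightarrow> real"
  have J: "J f s = 0" "(J f has_real_derivative f t) (at t)" if "continuous_on UNIV f" for f t
    using someI_ex[OF antiderivative_exists[OF that, of s]] by (auto simp: J_def)
  have J_cont: "continuous_on UNIV (J f)" if "continuous_on UNIV f" for f
    using J(2)[OF that] by (meson DERIV_continuous_on DERIV_subset UNIV_I subset_UNIV)
  define U where "U = rec_nat (\<lambda>_. 1) (\<lambda>_ f. J (\<lambda>t. J (\<lambda>x. R x * f x) t / P t))"
  define W where "W n = J (\<lambda>x. R x * U n x)" for n
  have U_simps: "U 0 = (\<lambda>_. 1)" "U (Suc n) = J (\<lambda>t. W n t / P t)" for n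
    by (auto simp: U_def W_def)
  have U_cont: "continuous_on UNIV (U n)" for n
  proof (induction n)
    case (Suc n)
    show ?case
      unfolding U_simps W_def
      by (intro J_cont continuous_intros Suc R P) (use P0 in \<open>auto simp: less_imp_neq[symmetric]\<close>)
  qed (simp add: U_simps)
  have RU: "continuous_on UNIV (\<lambda>x. R x * U n x)" for n
    by (intro continuous_intros R U_cont)
  have WP: "continuous_on UNIV (\<lambda>x. W n x / P x)" for n
    unfolding W_def by (intro continuous_intros J_cont R U_cont P) (use P0 in \<open>auto simp: less_imp_neq[symmetric]\<close>)
  have W: "W n s = 0" "(W n has_real_derivative R t * U n t) (at t)" for n t
    unfolding W_def using J[OF RU] by auto
  have US: "U (Suc n) s = 0" "(U (Suc n) has_real_derivative W n t / P t) (at t)" for n t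
    unfolding U_simps using J[OF WP] by auto
  \<comment> \<open>The head \<open>U 0 = 1\<close> is split off because only the later terms are
    antiderivatives vanishing at \<open>s\<close>, for which the derivative formula is
    available.\<close>
  define u where "u t = 1 + (\<Sum>n. U (Suc n) t)" for t
  define w where "w t = (\<Sum>n. W n t)" for t
  have main: "(u has_real_derivative w t / P t) (at t) \<and> (w has_real_derivative R t * u t) (at t)" for t
  proof -
    define N where "N = \<bar>t - s\<bar> + 1"
    have N: "0 < N" "\<bar>t - s\<bar> < N"
      by (auto simp: N_def)
    obtain r where r: "0 \<le> r" "\<And>x. x \<in> {s - N..s + N} \<Longrightarrow> \<bar>R x\<bar> \<le> r"
      using continuous_bounded_on_interval[OF continuous_on_subset[OF R subset_UNIV], of "s - N" "s + N"] by blast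
    have r': "\<bar>R x\<bar> \<le> r" if "\<bar>x - s\<bar> \<le> N" for x
      using that by (intro r(2)) (auto simp: abs_le_iff)
    \<comment> \<open>Each pass from \<open>U n\<close> to \<open>U (Suc n)\<close> integrates
      twice. One integration advances the power and the factorial; the factor
      \<open>\<bar>x - s\<bar> / Suc n\<close> gained by the other is estimated crudely by
      \<open>N\<close> and put into \<open>K\<close>, together with the bounds for \<open>R\<close>
      and \<open>1 / P\<close>.\<close>
    define K where "K = r * N / p1"
    have K: "0 \<le> K"
      using r N P by (simp add: K_def)
    have step: "\<bar>W n x\<bar> \<le> r * N * K ^ n * \<bar>x - s\<bar> ^ n / fact n"
      if U: "\<And>x. \<bar>x - s\<bar> \<le> N \<Longrightarrow> \<bar>U n x\<bar> \<le> K ^ n * \<bar>x - s\<bar> ^ n / fact n"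
        and x: "\<bar>x - s\<bar> \<le> N" for n x
    proof -
      have "\<bar>W n x\<bar> \<le> (r * K ^ n) * \<bar>x - s\<bar> ^ Suc n / fact (Suc n)"
      proof (rule antiderivative_bound[OF W _ x])
        fix y assume y: "\<bar>y - s\<bar> \<le> N"
        show "\<bar>R y * U n y\<bar> \<le> r * K ^ n * \<bar>y - s\<bar> ^ n / fact n"
          using mult_mono[OF r'[OF y] U[OF y]] r by (simp add: abs_mult mult.assoc)
      qed
      also have "\<dots> = (r * K ^ n * \<bar>x - s\<bar> ^ n / fact n) * (\<bar>x - s\<bar> / Suc n)"
        by (simp add: field_simps)
      also have "\<dots> \<le> (r * K ^ n * \<bar>x - s\<bar> ^ n / fact n) * (N / 1)"
        using x r K by (intro mult_left_mono frac_le) auto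
      finally show ?thesis
        by (simp add: mult_ac)
    qed
    have Ub: "\<bar>U n x\<bar> \<le> K ^ n * \<bar>x - s\<bar> ^ n / fact n" if "\<bar>x - s\<bar> \<le> N" for n x
      using that
    proof (induction n arbitrary: x)
      case (Suc n)
      show ?case
      proof (rule antiderivative_bound[OF US _ Suc.prems])
        fix y assume y: "\<bar>y - s\<bar> \<le> N"
        have "\<bar>W n y / P y\<bar> \<le> (r * N * K ^ n * \<bar>y - s\<bar> ^ n / fact n) / p1"
          by (rule divP[OF step[OF Suc.IH y]])
        then show "\<bar>W n y / P y\<bar> \<le> K ^ Suc n * \<bar>y - s\<bar> ^ n / fact n"
          by (simp add: K_def field_simps)
      qed
    qed (simp add: U_simps)
    have pw: "K ^ n * \<bar>x - s\<bar> ^ n / fact n \<le> (K * N) ^ n / fact n" if "\<bar>x - s\<bar> \<le> N" for n x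
      using that K by (auto simp: power_mult_distrib intro!: divide_right_mono mult_left_mono power_mono)
    have U1: "\<bar>U n x\<bar> \<le> 1 * (K * N) ^ n / fact n" if "\<bar>x - s\<bar> \<le> N" for n x
      using Ub[OF that] pw[OF that] by (metis mult_1 order_trans)
    have W1: "\<bar>W n x\<bar> \<le> (r * N) * (K * N) ^ n / fact n" if "\<bar>x - s\<bar> \<le> N" for n x
    proof -
      have "\<bar>W n x\<bar> \<le> (r * N) * (K ^ n * \<bar>x - s\<bar> ^ n / fact n)"
        using step[OF Ub that] by (simp add: mult_ac)
      also have "\<dots> \<le> (r * N) * ((K * N) ^ n / fact n)"
        using pw[OF that] r N by (intro mult_left_mono) auto
      finally show ?thesis
        by simp
    qed
    have RU1: "\<bar>R x * U n x\<bar> \<le> r * (K * N) ^ n / fact n" if "\<bar>x - s\<bar> \<le> N" for n x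
      using mult_mono[OF r'[OF that] U1[OF that]] r by (simp add: abs_mult)
    have WP1: "\<bar>W n x / P x\<bar> \<le> (r * N / p1) * (K * N) ^ n / fact n" if "\<bar>x - s\<bar> \<le> N" for n x
    proof -
      have "\<bar>W n x / P x\<bar> \<le> ((r * N) * (K * N) ^ n / fact n) / p1"
        by (rule divP[OF W1[OF that]])
      then show ?thesis
        by (simp add: field_simps)
    qed
    have dW: "summable (\<lambda>n. W n t)"
      "((\<lambda>t. \<Sum>n. W n t) has_real_derivative (\<Sum>n. R t * U n t)) (at t)"
      by (rule termwise_derivative[OF W(2) W1 RU1 N(2)]; assumption)+
    have U2: "\<bar>U (Suc n) x\<bar> \<le> (K * N) * (K * N) ^ n / fact n" if "\<bar>x - s\<bar> \<le> N" for n x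
    proof -
      have "1 * (K * N) ^ Suc n / fact (Suc n) \<le> (K * N) ^ Suc n / fact n"
        using K N by (intro frac_le) (auto simp: fact_mono)
      then show ?thesis
        using order_trans[OF U1[OF that, of "Suc n"]] by simp
    qed
    have dU: "summable (\<lambda>n. U (Suc n) t)"
      "((\<lambda>t. \<Sum>n. U (Suc n) t) has_real_derivative (\<Sum>n. W n t / P t)) (at t)"
      by (rule termwise_derivative[OF US(2) U2 WP1 N(2)]; assumption)+
    have "((\<lambda>t. 1 + (\<Sum>n. U (Suc n) t)) has_real_derivative (\<Sum>n. W n t / P t)) (at t)"
      using DERIV_add[OF DERIV_const[of 1] dU(2)] by (simp only: add_0_left)
    moreover have "(\<Sum>n. W n t / P t) = w t / P t"
      unfolding w_def using dW(1) by (rule suminf_divide)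
    moreover have "(\<Sum>n. R t * U n t) = R t * u t"
    proof -
      have sU: "summable (\<lambda>n. U n t)"
        using dU(1) by (subst (asm) summable_Suc_iff)
      have "u t = (\<Sum>n. U n t)"
        using suminf_split_head[OF sU] by (simp add: u_def U_simps(1))
      then show ?thesis
        using suminf_mult[OF sU] by simp
    qed
    ultimately show ?thesis
      using dW(2) by (simp add: u_def[abs_def] w_def[abs_def])
  qed
  have "u s = 1"
    by (simp add: u_def US)
  moreover have "w s = 0"
    by (simp add: w_def W)
  ultimately show ?thesis
    using main by blast
qed

lemma continuous_on_of_DERIV:
  fixes f f' :: "real \<Rightarrow> real"
  assumes "\<And>t. (f has_real_derivative f' t) (at t)"
  shows "continuous_on S f"
  using assms by (intro DERIV_continuous_on) (rule has_field_derivative_at_within)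

section \<open>Zeros as functions of the weight\<close>

text \<open>\<open>M\<close> may change sign and the bounds hold on the whole line, so the
  assumptions survive reflection of \<open>t\<close> and multiplication of \<open>M\<close> by a
  constant. Reinterpreting the locale for such coefficients yields the results on
  \<open>psi1\<close> and on negative weights.\<close>

locale sl_coeffs =
  fixes P Q M :: "real \<Rightarrow> real" and p1 p2 q2 :: real
  assumes P_cont: "continuous_on UNIV P" and Q_cont: "continuous_on UNIV Q"
    and M_cont: "continuous_on UNIV M"
    and p1_pos: "0 < p1" and P_ge: "\<And>t. p1 \<le> P t" and P_le: "\<And>t. P t \<le> p2"
    and Q_nonneg: "\<And>t. 0 \<le> Q t" and Q_le: "\<And>t. Q t \<le> q2"
begin

lemma P_pos: "0 < P t"
  using P_ge[of t] p1_pos by simp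

lemma R_cont: "continuous_on S (\<lambda>t. Q t - a * M t)"
  by (intro continuous_intros continuous_on_subset[OF Q_cont] continuous_on_subset[OF M_cont]) auto

abbreviation sol :: "real \<Rightarrow> real \<Rightarrow> real \<Rightarrow> real" where
  "sol a s \<equiv> sol_v P Q M a s"

text \<open>Taken through \<open>deriv\<close> because \<open>sol_v\<close> singles out only the
  function, its derivative being hidden under the existential quantifier.\<close>

definition flux :: "real \<Rightarrow> real \<Rightarrow> real \<Rightarrow> real" where
  "flux a s t = P t * deriv (sol a s) t"

lemma sl_pair_of_solves_SL:
  assumes "solves_SL P Q (\<lambda>t x. a * M t * x) UNIV v dv"
  shows "sl_pair P (\<lambda>t. Q t - a * M t) (\<lambda>_. 0) c d v (\<lambda>t. P t * dv t)"
proof -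
  have d: "(v has_real_derivative dv t) (at t)"
    "((\<lambda>s. P s * dv s) has_real_derivative (Q t * v t - a * M t * v t)) (at t)" for t
    using assms by (auto simp: solves_SL_def)
  show ?thesis
    unfolding sl_pair_def
  proof (intro conjI ballI)
    show "continuous_on {c..d} v" "continuous_on {c..d} (\<lambda>t. P t * dv t)"
      by (rule continuous_on_of_DERIV, rule d)+
    show "(v has_real_derivative P t * dv t / P t) (at t)" for t
      using d(1) P_pos[of t] by simp
    show "((\<lambda>t. P t * dv t) has_real_derivative (Q t - a * M t) * v t + 0) (at t)" for t
      using d(2)[of t] by (simp add: algebra_simps)
  qed
qed

text \<open>The Picard solution satisfies the description in \<open>sol_v\<close>, and any
  competitor agrees with it at each \<open>t\<close> by uniqueness on the interval between
  \<open>s\<close> and \<open>t\<close>.\<close>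

lemma sol_props:
  shows sol_init: "sol a s s = 1" and flux_init: "flux a s s = 0"
    and DERIV_sol: "(sol a s has_real_derivative flux a s t / P t) (at t)"
    and DERIV_flux: "(flux a s has_real_derivative (Q t - a * M t) * sol a s t) (at t)"
proof -
  obtain u w where u: "u s = 1" "w s = 0"
    "\<And>t. (u has_real_derivative w t / P t) (at t)"
    "\<And>t. (w has_real_derivative (Q t - a * M t) * u t) (at t)"
    using sl_exists[OF P_cont P_ge p1_pos R_cont[of UNIV a], of s] by blast
  have Pw: "(\<lambda>t. P t * (w t / P t)) = w"
    using P_pos by (auto simp: less_le)
  have uw: "solves_SL P Q (\<lambda>t x. a * M t * x) UNIV u (\<lambda>t. w t / P t)"
    using u unfolding solves_SL_def Pw by (simp add: left_diff_distrib)
  have "sol a s = u"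
    unfolding sol_v_def
  proof (rule the_equality)
    show "\<exists>dv. solves_SL P Q (\<lambda>t x. a * M t * x) UNIV u dv \<and> u s = 1 \<and> dv s = 0"
      using uw u by auto
    fix v assume "\<exists>dv. solves_SL P Q (\<lambda>t x. a * M t * x) UNIV v dv \<and> v s = 1 \<and> dv s = 0"
    then obtain dv where v: "solves_SL P Q (\<lambda>t x. a * M t * x) UNIV v dv" "v s = 1" "dv s = 0"
      by blast
    show "v = u"
    proof
      fix t
      show "v t = u t"
        using sl_pair_unique(1)[OF sl_pair_of_solves_SL[OF v(1)] sl_pair_of_solves_SL[OF uw] P_ge p1_pos R_cont,
            where c = "min s t" and d = "max s t" and s = s and t = t and k = 1] v u by auto
    qed
  qed
  moreover have "flux a s = w"
    unfolding flux_def[abs_def] calculation using DERIV_imp_deriv[OF u(3)] Pw by simp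
  ultimately show "sol a s s = 1" "flux a s s = 0"
    "(sol a s has_real_derivative flux a s t / P t) (at t)"
    "(flux a s has_real_derivative (Q t - a * M t) * sol a s t) (at t)"
    using u by auto
qed

lemma sol_cont: "continuous_on S (sol a s)" and flux_cont: "continuous_on S (flux a s)"
  by (rule continuous_on_of_DERIV, rule DERIV_sol DERIV_flux)+

lemma sl_pair_sol: "sl_pair P (\<lambda>t. Q t - a * M t) (\<lambda>_. 0) c d (sol a s) (flux a s)"
  using DERIV_sol DERIV_flux by (auto simp: sl_pair_def sol_cont flux_cont)

text \<open>Value and flux vanishing at one point would force the zero solution, against the value 1
  at \<open>s\<close>. Thus all zeros are simple.\<close>

lemma flux_nonzero:
  assumes "sol a s t = 0"
  shows "flux a s t \<noteq> 0"
proof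
  assume "flux a s t = 0"
  then have "sol a s s = 0"
    using sl_pair_zero(1)[OF sl_pair_sol P_ge p1_pos R_cont, where c = "min s t" and d = "max s t"
        and s = t and t = s, OF _ assms] by auto
  then show False
    by (simp add: sol_init)
qed

section \<open>The zero nearest to the base point\<close>

lemma sol_pos_right_flux_pos:
  assumes "sol a s c = 0" "c < d" "\<And>t. c < t \<Longrightarrow> t < d \<Longrightarrow> 0 < sol a s t"
  shows "0 < flux a s c"
proof (rule ccontr)
  assume "\<not> 0 < flux a s c"
  then have "flux a s c / P c < 0"
    using flux_nonzero[OF assms(1)] P_pos[of c] by (simp add: divide_neg_pos)
  then obtain e where e: "0 < e" "\<And>h. 0 < h \<Longrightarrow> h < e \<Longrightarrow> sol a s (c + h) < sol a s c"
    using DERIV_neg_dec_right[OF DERIV_sol] by blast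
  have "sol a s (c + min (e / 2) ((d - c) / 2)) < sol a s c"
    using e(1) assms(2) by (intro e(2)) auto
  moreover have "0 < sol a s (c + min (e / 2) ((d - c) / 2))"
    using e(1) assms(2) by (intro assms(3)) (auto simp: min_def field_simps)
  ultimately show False
    using assms(1) by simp
qed

lemma sol_pos_of_no_zero:
  assumes "\<And>t. c < t \<Longrightarrow> t < s \<Longrightarrow> sol a s t \<noteq> 0" "c < t" "t \<le> s"
  shows "0 < sol a s t"
proof (rule ccontr)
  assume "\<not> 0 < sol a s t"
  then have "\<exists>x. t \<le> x \<and> x \<le> s \<and> sol a s x = 0"
    using assms(3) sol_cont by (intro IVT') (auto simp: sol_init)
  then obtain x where "t \<le> x" "x \<le> s" "sol a s x = 0"
    by blast
  then show False
    using assms(1)[of x] assms(2) sol_init[of a s] by (cases "x = s") auto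
qed

lemma last_zero_exists:
  assumes "sol a s t0 = 0" "t0 \<le> s"
  obtains c where "t0 \<le> c" "c < s" "sol a s c = 0" "\<And>t. c < t \<Longrightarrow> t \<le> s \<Longrightarrow> 0 < sol a s t"
proof -
  let ?Z = "{t \<in> {t0..s}. sol a s t = 0}"
  have "closed ?Z"
    by (intro continuous_closed_preimage_constant sol_cont) auto
  moreover have "bounded ?Z"
    by (rule bounded_subset[of "{t0..s}"]) auto
  ultimately have "compact ?Z"
    by (simp add: compact_eq_bounded_closed)
  moreover have "?Z \<noteq> {}"
    using assms by auto
  ultimately obtain c where c: "c \<in> ?Z" "\<And>t. t \<in> ?Z \<Longrightarrow> t \<le> c"
    using compact_attains_sup[of ?Z] by blast
  have "c \<noteq> s"
    using c sol_init[of a s] by auto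
  show ?thesis
  proof (rule that)
    show "0 < sol a s t" if "c < t" "t \<le> s" for t
    proof (rule sol_pos_of_no_zero[OF _ that])
      fix x assume "c < x" "x < s"
      then show "sol a s x \<noteq> 0"
        using c(1) c(2)[of x] by auto
    qed
  qed (use c \<open>c \<noteq> s\<close> in auto)
qed

text \<open>Trades the extended-real supremum for a sign pattern. Compactness makes the supremum
  attained, and the value 1 at \<open>s\<close> turns absence of zeros into positivity.\<close>

lemma psi2_eq_iff:
  "psi2 P Q M s a = ereal c \<longleftrightarrow> c < s \<and> sol a s c = 0 \<and> (\<forall>t. c < t \<longrightarrow> t \<le> s \<longrightarrow> 0 < sol a s t)"
proof -
  have *: "psi2 P Q M s a = ereal c"
    if "c < s" "sol a s c = 0" "\<And>t. c < t \<Longrightarrow> t \<le> s \<Longrightarrow> 0 < sol a s t" for c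
    unfolding psi2_def
  proof (rule Sup_eqI)
    fix y assume "y \<in> ereal ` {t. t < s \<and> sol a s t = 0}"
    then show "y \<le> ereal c"
      using that(3) by (force simp: not_less[symmetric])
  next
    fix y assume "\<And>x. x \<in> ereal ` {t. t < s \<and> sol a s t = 0} \<Longrightarrow> x \<le> y"
    then show "ereal c \<le> y"
      using that by auto
  qed
  show ?thesis
  proof
    assume psi: "psi2 P Q M s a = ereal c"
    \<comment> \<open>Without zeros the supremum would be that of the empty set, hence
      \<open>- \<infinity>\<close> and no real number.\<close>
    have "\<exists>t. t < s \<and> sol a s t = 0"
    proof (rule ccontr)
      assume "\<not> ?thesis"
      then have *: "{t. t < s \<and> sol a s t = 0} = {}"
        by blast
      show False
        using psi unfolding psi2_def * by (simp add: bot_ereal_def)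
    qed
    then obtain t0 where "t0 < s" "sol a s t0 = 0"
      by blast
    then obtain c' where c': "c' < s" "sol a s c' = 0" "\<And>t. c' < t \<Longrightarrow> t \<le> s \<Longrightarrow> 0 < sol a s t"
      using last_zero_exists[of a s t0] by (metis less_imp_le)
    then have "c' = c"
      using psi *[OF c'] by simp
    then show "c < s \<and> sol a s c = 0 \<and> (\<forall>t. c < t \<longrightarrow> t \<le> s \<longrightarrow> 0 < sol a s t)"
      using c' by blast
  qed (use * in blast)
qed

lemma psi2_of_zero:
  assumes "sol a s t0 = 0" "t0 \<le> s"
  obtains c where "t0 \<le> c" "c < s" "psi2 P Q M s a = ereal c"
  using last_zero_exists[OF assms] unfolding psi2_eq_iff by metis

text \<open>Otherwise the flux is nondecreasing on the interval, although it is positive at the zero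
  \<open>c\<close> and vanishes at \<open>s\<close>. This confines the zeros by the sign sets, and
  it excludes the weight 0.\<close>

lemma psi2_weight_positive_somewhere:
  assumes "psi2 P Q M s a = ereal c"
  obtains t where "c < t" "t < s" "0 < a * M t"
proof -
  have c: "c < s" "sol a s c = 0" "\<And>t. c < t \<Longrightarrow> t \<le> s \<Longrightarrow> 0 < sol a s t"
    using assms by (auto simp: psi2_eq_iff)
  have "\<exists>t. c < t \<and> t < s \<and> 0 < a * M t"
  proof (rule ccontr)
    assume "\<not> ?thesis"
    then have neg: "a * M t \<le> 0" if "c < t" "t < s" for t
      using that by (meson not_less)
    have "flux a s c \<le> flux a s s"
    proof (rule mono_of_deriv_nonneg[OF flux_cont DERIV_flux])
      fix t assume "c < t" "t < s"
      then show "0 \<le> (Q t - a * M t) * sol a s t"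
        using neg[of t] c(3)[of t] Q_nonneg[of t] by (intro mult_nonneg_nonneg) auto
    qed (use c in auto)
    moreover have "0 < flux a s c"
      by (rule sol_pos_right_flux_pos[of _ _ _ s]) (use c in auto)
    ultimately show False
      by (simp add: flux_init)
  qed
  then show ?thesis
    using that by blast
qed

section \<open>Oscillation, strict monotonicity and range of the zero-function\<close>

lemma zero_for_large_weight:
  assumes "c < d" "0 < \<delta>" "\<And>t. t \<in> {c..d} \<Longrightarrow> \<delta> \<le> M t"
  obtains A where "0 < A" "\<And>a s. A \<le> a \<Longrightarrow> \<exists>t\<in>{c..d}. sol a s t = 0"
proof -
  define k where "k = pi / (d - c)"
  \<comment> \<open>The comparison equation has constant coefficients \<open>p2\<close> and
    \<open>- p2 * k\<^sup>2\<close>, with \<open>k\<close> chosen so that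
    \<open>sin (k * (t - c))\<close> has consecutive zeros \<open>c\<close> and \<open>d\<close>.
    From \<open>A\<close> on, \<open>Q - a * M\<close> lies below
    \<open>- p2 * k\<^sup>2 - 1\<close>, and the extra 1 makes the decrease of \<open>G\<close>
    strict. \<open>A\<close> does not depend on the base point \<open>s\<close>.\<close>
  define A where "A = (p2 * k\<^sup>2 + q2 + 1) / \<delta>"
  have k: "0 < k" "k * (d - c) = pi"
    using assms(1) by (auto simp: k_def)
  have p2: "0 < p2" "0 \<le> q2"
    using P_pos[of 0] P_le[of 0] Q_nonneg[of 0] Q_le[of 0] by auto
  show ?thesis
  proof (rule that[of A])
    show "0 < A"
      using assms p2 k by (auto simp: A_def intro!: divide_pos_pos add_nonneg_pos)
    fix a s assume "A \<le> a"
    then have a: "p2 * k\<^sup>2 + q2 + 1 \<le> a * \<delta>" "0 < a"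
      using assms(2) \<open>0 < A\<close> by (simp add: A_def pos_divide_le_eq, linarith)
    show "\<exists>t\<in>{c..d}. sol a s t = 0"
    proof (rule ccontr)
      assume "\<not> ?thesis"
      then have nz: "sol a s t \<noteq> 0" if "c \<le> t" "t \<le> d" for t
        using that by auto
      let ?u = "sol a s" and ?w = "flux a s"
      \<comment> \<open>Picone's identity with the test function \<open>sin (k (t - c))\<close>, which vanishes at both ends.\<close>
      define G where "G t = (sin (k * (t - c)))\<^sup>2 * (?w t / ?u t) - p2 * k / 2 * sin (2 * (k * (t - c)))" for t
      define G' where "G' t = 2 * sin (k * (t - c)) * (k * cos (k * (t - c))) * ?w t / ?u t
        + (sin (k * (t - c)))\<^sup>2 * ((Q t - a * M t) - (?w t)\<^sup>2 / (P t * (?u t)\<^sup>2))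
        - p2 * k\<^sup>2 * cos (2 * (k * (t - c)))" for t
      have "G d < G c"
      proof (rule DERIV_neg_imp_decreasing_open[OF assms(1)])
        show "continuous_on {c..d} G"
          unfolding G_def by (intro continuous_intros sol_cont flux_cont) (use nz in auto)
        fix t assume t: "c < t" "t < d"
        define S where "S = sin (k * (t - c))"
        define C where "C = cos (k * (t - c))"
        define r where "r = ?w t / ?u t"
        have Pt: "0 < P t" "P t \<le> p2"
          using P_pos P_le by auto
        have "0 < S"
          unfolding S_def
        proof (rule sin_gt_zero)
          show "0 < k * (t - c)" using k t by simp
          have "k * (t - c) < k * (d - c)" using k t by (intro mult_strict_left_mono) auto
          then show "k * (t - c) < pi" using k by simp
        qed
        have SC: "S\<^sup>2 + C\<^sup>2 = 1"
          by (simp add: S_def C_def)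
        \<comment> \<open>Completing the square bounds the cross term in \<open>G'\<close> by the
          energy of the test function.\<close>
        have sq: "0 \<le> P t * (k * C - S * r / P t)\<^sup>2"
          using Pt by simp
        have "P t * (k * C - S * r / P t)\<^sup>2 = P t * (k * C)\<^sup>2 - 2 * S * (k * C) * r + S\<^sup>2 * (r\<^sup>2 / P t)"
          using Pt by (simp add: field_simps power2_eq_square)
        with sq have "2 * S * (k * C) * r - S\<^sup>2 * (r\<^sup>2 / P t) \<le> P t * (k * C)\<^sup>2"
          by linarith
        also have "\<dots> \<le> p2 * (k * C)\<^sup>2"
          using Pt by (intro mult_right_mono) auto
        finally have 1: "2 * S * (k * C) * r - S\<^sup>2 * (r\<^sup>2 / P t) \<le> p2 * (k * C)\<^sup>2" .
        have "a * \<delta> \<le> a * M t"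
          using a assms(3)[of t] t by (intro mult_left_mono) auto
        then have "Q t - a * M t \<le> - p2 * k\<^sup>2 - 1"
          using a(1) Q_le[of t] by linarith
        then have 2: "S\<^sup>2 * (Q t - a * M t) \<le> S\<^sup>2 * (- p2 * k\<^sup>2 - 1)"
          by (intro mult_left_mono) auto
        have "G' t = 2 * S * (k * C) * r - S\<^sup>2 * (r\<^sup>2 / P t) + S\<^sup>2 * (Q t - a * M t)
            - p2 * k\<^sup>2 * (C\<^sup>2 - S\<^sup>2)"
          unfolding G'_def S_def[symmetric] C_def[symmetric] cos_double r_def
          by (simp add: right_diff_distrib power_divide mult.commute)
        also have "\<dots> \<le> p2 * (k * C)\<^sup>2 + S\<^sup>2 * (- p2 * k\<^sup>2 - 1) - p2 * k\<^sup>2 * (C\<^sup>2 - S\<^sup>2)"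
          using 1 2 by linarith
        also have "\<dots> = - S\<^sup>2"
          by (simp add: algebra_simps power2_eq_square)
        finally have "G' t < 0"
          using \<open>0 < S\<close> by (smt (verit) zero_less_power)
        moreover have "(G has_real_derivative G' t) (at t)"
        proof -
          have dphi: "((\<lambda>t. (sin (k * (t - c)))\<^sup>2) has_real_derivative 2 * S * (k * C)) (at t)"
            unfolding S_def C_def by (auto intro!: derivative_eq_intros)
          have dr: "((\<lambda>t. ?w t / ?u t) has_real_derivative
              ((Q t - a * M t) * ?u t * ?u t - ?w t * (?w t / P t)) / (?u t * ?u t)) (at t)"
            using nz[of t] t by (intro DERIV_divide DERIV_sol DERIV_flux) auto
          have ds: "((\<lambda>t. p2 * k / 2 * sin (2 * (k * (t - c)))) has_real_derivative
              p2 * k\<^sup>2 * cos (2 * (k * (t - c)))) (at t)"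
            by (auto intro!: derivative_eq_intros simp: power2_eq_square)
          have "2 * S * (k * C) * (?w t / ?u t)
              + ((Q t - a * M t) * ?u t * ?u t - ?w t * (?w t / P t)) / (?u t * ?u t) * S\<^sup>2
              - p2 * k\<^sup>2 * cos (2 * (k * (t - c))) = G' t"
            unfolding G'_def S_def[symmetric] C_def[symmetric]
            using nz[of t] t Pt by (simp add: diff_divide_distrib power2_eq_square mult_ac)
          moreover note DERIV_diff[OF DERIV_mult[OF dphi dr] ds]
          ultimately show ?thesis
            unfolding G_def[abs_def] S_def by simp
        qed
        ultimately show "\<exists>y. (G has_real_derivative y) (at t) \<and> y < 0"
          by blast
      qed
      moreover have "G c = 0" "G d = 0"
        by (auto simp: G_def k)
      ultimately show False
        by simp
    qed
  qed
qed

text \<open>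
  Picone's identity with the flux of the first solution scaled by \<open>a' / a\<close>. The scaling makes the
  terms with \<open>M\<close> cancel, so that \<open>M\<close> may change sign.
\<close>

lemma scaled_picone:
  assumes a: "0 < a" "a < a'"
    and y: "\<And>t. c < t \<Longrightarrow> t \<le> s \<Longrightarrow> 0 < sol a' s t"
    and t: "c < t" "t \<le> s"
  shows "(a' / a) * sol a s t * flux a s t \<le> (sol a s t)\<^sup>2 * flux a' s t / sol a' s t"
proof -
  let ?u = "sol a s" and ?w = "flux a s" and ?y = "sol a' s" and ?z = "flux a' s"
  \<comment> \<open>Both fluxes vanish at \<open>s\<close>, so \<open>G s = 0\<close> and the claim
    is that \<open>G t\<close> does not exceed it.\<close>
  define G where "G t = (a' / a) * (?u t * ?w t) - (?u t)\<^sup>2 * (?z t / ?y t)" for t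
  define G' where "G' t = (a' / a) * (?w t / P t * ?w t + (Q t - a * M t) * ?u t * ?u t)
    - (2 * ?u t * (?w t / P t) * (?z t / ?y t)
       + ((Q t - a' * M t) * ?y t * ?y t - ?z t * (?z t / P t)) / (?y t * ?y t) * (?u t)\<^sup>2)" for t
  have "G t \<le> G s"
  proof (rule mono_of_deriv_nonneg[where c = t and d = s and f = G and f' = G'])
    show "continuous_on {t..s} G"
      unfolding G_def using y t by (intro continuous_intros sol_cont flux_cont) (metis atLeastAtMost_iff less_irrefl less_le_trans)
    fix x assume x: "t < x" "x < s"
    have yx: "0 < ?y x"
      using y x t by simp
    have Px: "0 < P x"
      by (rule P_pos)
    have d1: "((\<lambda>t. (a' / a) * (?u t * ?w t)) has_real_derivative
        (a' / a) * (?w x / P x * ?w x + (Q x - a * M x) * ?u x * ?u x)) (at x)"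
      by (intro DERIV_cmult DERIV_mult DERIV_sol DERIV_flux)
    have d2: "((\<lambda>t. (?u t)\<^sup>2) has_real_derivative 2 * ?u x * (?w x / P x)) (at x)"
      by (rule derivative_eq_intros DERIV_sol refl)+ simp
    have d3: "((\<lambda>t. ?z t / ?y t) has_real_derivative
        ((Q x - a' * M x) * ?y x * ?y x - ?z x * (?z x / P x)) / (?y x * ?y x)) (at x)"
      using yx by (intro DERIV_divide DERIV_sol DERIV_flux) auto
    show "(G has_real_derivative G' x) (at x)"
      using DERIV_diff[OF d1 DERIV_mult[OF d2 d3]] by (simp add: G_def[abs_def] G'_def)
    define r where "r = ?z x / ?y x"
    define k where "k = a' / a"
    have k: "1 < k" "a' = k * a"
      using a by (auto simp: k_def)
    have "G' x = k * (?w x / P x * ?w x + (Q x - a * M x) * ?u x * ?u x)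
      - (2 * ?u x * (?w x / P x) * r + ((Q x - a' * M x) - r\<^sup>2 / P x) * (?u x)\<^sup>2)"
      unfolding G'_def r_def k_def using yx by (simp add: diff_divide_distrib power2_eq_square)
    \<comment> \<open>With \<open>a' = k * a\<close> the contributions \<open>- k * a * M\<close>
      and \<open>+ a' * M\<close> cancel. What remains is \<open>k - 1\<close> times the energy of
      the first solution, nonnegative since \<open>0 \<le> Q\<close>, plus a square.\<close>
    also have "\<dots> = (k - 1) * ((?w x)\<^sup>2 / P x + Q x * (?u x)\<^sup>2) + (?w x - ?u x * r)\<^sup>2 / P x"
      unfolding k(2) using Px by (simp add: field_simps power2_eq_square)
    also have "0 \<le> \<dots>"
      using k Px Q_nonneg by (intro add_nonneg_nonneg mult_nonneg_nonneg divide_nonneg_pos) auto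
    finally show "0 \<le> G' x" .
  qed (use t in auto)
  then show ?thesis
    by (simp add: G_def flux_init mult.assoc)
qed

text \<open>If the second solution had no zero in the open interval, the scaled inequality could be
  divided by \<open>sol a s t\<close> and \<open>t\<close> sent to \<open>c\<close> from the right.
  Its left side tends to \<open>a' / a\<close> times the positive flux at \<open>c\<close>, its
  right side to that flux or to 0, depending on whether the second solution vanishes at
  \<open>c\<close>. Both are impossible as \<open>a' / a > 1\<close>; the former case gives the
  strictness.\<close>

lemma psi2_strict_mono:
  assumes a: "0 < a" "a < a'" and c: "psi2 P Q M s a = ereal c"
  obtains c' where "c < c'" "psi2 P Q M s a' = ereal c'"
proof -
  let ?u = "sol a s" and ?w = "flux a s" and ?y = "sol a' s" and ?z = "flux a' s"
  have cs: "c < s" and uc: "?u c = 0" and u: "\<And>t. c < t \<Longrightarrow> t \<le> s \<Longrightarrow> 0 < ?u t"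
    using c by (auto simp: psi2_eq_iff)
  have "\<exists>t. c < t \<and> t < s \<and> ?y t = 0"
  proof (rule ccontr)
    assume no_zero: "\<not> ?thesis"
    have y: "0 < ?y t" if "c < t" "t \<le> s" for t
      by (rule sol_pos_of_no_zero[OF _ that]) (use no_zero in auto)
    have wc: "0 < ?w c"
      by (rule sol_pos_right_flux_pos[OF uc cs]) (use u in auto)
    have at_c: "(sol b s \<longlongrightarrow> sol b s c) (at_right c)" "(flux b s \<longlongrightarrow> flux b s c) (at_right c)" for b
      using sol_cont[of UNIV b s] flux_cont[of UNIV b s]
      by (auto simp: continuous_on_def intro: tendsto_within_subset)
    have ineq: "(a' / a) * ?w t \<le> ?u t / ?y t * ?z t" if "c < t" "t < s" for t
    proof -
      have "?u t * ((a' / a) * ?w t) \<le> ?u t * (?u t / ?y t * ?z t)"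
        using scaled_picone[OF a y that(1)] that by (simp add: power2_eq_square mult_ac)
      then show ?thesis
        by (rule mult_left_le_imp_le) (use u that in auto)
    qed
    have lim: "((\<lambda>t. ?u t / ?y t * ?z t) \<longlongrightarrow> (if ?y c = 0 then ?w c else 0)) (at_right c)"
    proof (cases "?y c = 0")
      case False
      then have "((\<lambda>t. ?u t / ?y t * ?z t) \<longlongrightarrow> ?u c / ?y c * ?z c) (at_right c)"
        by (intro tendsto_intros at_c)
      then show ?thesis
        using False uc by simp
    next
      case True
      have zc: "0 < ?z c"
        by (rule sol_pos_right_flux_pos[OF True cs]) (use y in auto)
      \<comment> \<open>Both solutions vanish at \<open>c\<close>, so their ratio is that of the
        difference quotients at \<open>c\<close>; \<open>P c\<close> cancels in the limit.\<close>
      have q: "((\<lambda>t. (sol b s t - sol b s c) / (t - c)) \<longlongrightarrow> flux b s c / P c) (at_right c)" for b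
        using DERIV_sol[of b s c] unfolding has_field_derivative_iff
        by (rule tendsto_within_subset) simp
      have "((\<lambda>t. ((?u t - ?u c) / (t - c)) / ((?y t - ?y c) / (t - c)) * ?z t)
          \<longlongrightarrow> (?w c / P c) / (?z c / P c) * ?z c) (at_right c)"
        using zc P_pos[of c] by (intro tendsto_intros q at_c) auto
      moreover have "\<forall>\<^sub>F t in at_right c.
          ((?u t - ?u c) / (t - c)) / ((?y t - ?y c) / (t - c)) * ?z t = ?u t / ?y t * ?z t"
        using eventually_at_right_less[of c] by eventually_elim (simp add: uc True)
      ultimately have "((\<lambda>t. ?u t / ?y t * ?z t) \<longlongrightarrow> (?w c / P c) / (?z c / P c) * ?z c) (at_right c)"
        by (rule Lim_transform_eventually)
      moreover have "(?w c / P c) / (?z c / P c) * ?z c = ?w c"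
        using zc P_pos[of c] by simp
      ultimately show ?thesis
        using True by simp
    qed
    have "\<forall>\<^sub>F t in at_right c. (a' / a) * ?w t \<le> ?u t / ?y t * ?z t"
      using eventually_at_right_real[OF cs] by eventually_elim (use ineq in auto)
    then have "(a' / a) * ?w c \<le> (if ?y c = 0 then ?w c else 0)"
      by (intro tendsto_le[OF _ lim tendsto_mult[OF tendsto_const at_c(2)]]) auto
    moreover have "1 * ?w c < (a' / a) * ?w c"
      using a wc by (intro mult_strict_right_mono) auto
    ultimately show False
      using wc by (auto split: if_splits)
  qed
  then obtain t where t: "c < t" "t < s" "?y t = 0"
    by blast
  show ?thesis
    using psi2_of_zero[OF t(3)] t that by (metis less_imp_le less_le_trans)
qed

text \<open>The difference of two solutions satisfies the equation for \<open>b\<close> with the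
  inhomogeneity \<open>(a - b) * M * sol a s\<close> and zero initial data at \<open>s\<close>, so
  the energy estimate bounds it linearly in \<open>\<bar>b - a\<bar>\<close>.\<close>

lemma sol_continuous_in_weight:
  assumes "0 < e"
  obtains \<delta> where "0 < \<delta>"
    "\<And>b t. \<bar>b - a\<bar> < \<delta> \<Longrightarrow> t \<in> {c..s} \<Longrightarrow> \<bar>sol b s t - sol a s t\<bar> < e"
proof -
  have "continuous_on {c..s} (\<lambda>t. M t * sol a s t)"
    by (intro continuous_intros sol_cont continuous_on_subset[OF M_cont]) auto
  then obtain B where B: "0 \<le> B" "\<And>t. t \<in> {c..s} \<Longrightarrow> \<bar>M t * sol a s t\<bar> \<le> B"
    using continuous_bounded_on_interval by blast
  obtain m where m: "0 \<le> m" "\<And>t. t \<in> {c..s} \<Longrightarrow> \<bar>M t\<bar> \<le> m"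
    using continuous_bounded_on_interval[OF continuous_on_subset[OF M_cont]] by blast
  define r where "r = q2 + (\<bar>a\<bar> + 1) * m"
  define L where "L = exp ((1 / p1 + r + 1) * \<bar>c - s\<bar>)"
  \<comment> \<open>The 1 keeps \<open>\<bar>b\<bar> \<le> \<bar>a\<bar> + 1\<close>, which makes
    \<open>r\<close> uniform in \<open>b\<close>; \<open>B + 1\<close> avoids a division by zero
    when \<open>B = 0\<close>.\<close>
  define \<delta> where "\<delta> = min 1 (e / (sqrt L * (B + 1)))"
  have L: "0 < L"
    by (simp add: L_def)
  have r0: "0 \<le> r"
    using m Q_nonneg[of 0] Q_le[of 0] by (simp add: r_def)
  have \<delta>: "0 < \<delta>"
    using assms L B by (simp add: \<delta>_def)
  show ?thesis
  proof (rule that[OF \<delta>])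
    fix b t assume b: "\<bar>b - a\<bar> < \<delta>" and t: "t \<in> {c..s}"
    let ?k = "\<bar>b - a\<bar> * B"
    have sl: "sl_pair P (\<lambda>t. Q t - b * M t) (\<lambda>t. (a - b) * (M t * sol a s t)) c s
        (\<lambda>t. sol b s t - sol a s t) (\<lambda>t. flux b s t - flux a s t)"
      unfolding sl_pair_def
    proof (intro conjI ballI continuous_intros sol_cont flux_cont)
      fix x
      show "((\<lambda>t. sol b s t - sol a s t) has_real_derivative (flux b s x - flux a s x) / P x) (at x)"
        using DERIV_diff[OF DERIV_sol DERIV_sol] by (simp add: diff_divide_distrib)
      show "((\<lambda>t. flux b s t - flux a s t) has_real_derivative
          (Q x - b * M x) * (sol b s x - sol a s x) + (a - b) * (M x * sol a s x)) (at x)"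
        by (rule DERIV_cong[OF DERIV_diff[OF DERIV_flux DERIV_flux]]) (simp add: algebra_simps)
    qed
    have "\<bar>Q x - b * M x\<bar> \<le> r" if "x \<in> {c..s}" for x
    proof -
      have "\<bar>b * M x\<bar> \<le> (\<bar>a\<bar> + 1) * m"
        unfolding abs_mult using b m that by (intro mult_mono) (auto simp: \<delta>_def)
      then show ?thesis
        using Q_nonneg[of x] Q_le[of x] unfolding r_def by linarith
    qed
    moreover have "\<bar>(a - b) * (M x * sol a s x)\<bar> \<le> ?k" if "x \<in> {c..s}" for x
      unfolding abs_mult[of "a - b"] abs_minus_commute[of a b] using B that by (intro mult_left_mono) auto
    ultimately have "(sol b s t - sol a s t)\<^sup>2 + (flux b s t - flux a s t)\<^sup>2 + ?k\<^sup>2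
      \<le> ((sol b s s - sol a s s)\<^sup>2 + (flux b s s - flux a s s)\<^sup>2 + ?k\<^sup>2) * exp ((1 / p1 + r + 1) * \<bar>t - s\<bar>)"
      using t r0 by (intro sl_pair_energy[OF sl P_ge p1_pos]) auto
    also have "\<dots> = ?k\<^sup>2 * exp ((1 / p1 + r + 1) * \<bar>t - s\<bar>)"
      by (simp add: sol_init flux_init)
    also have "\<dots> \<le> ?k\<^sup>2 * L"
      unfolding L_def using t r0 p1_pos by (intro mult_left_mono exp_le_cancel_iff[THEN iffD2] mult_left_mono) auto
    finally have "(sol b s t - sol a s t)\<^sup>2 \<le> ?k\<^sup>2 * L"
      by (smt (verit) zero_le_power2)
    then have "\<bar>sol b s t - sol a s t\<bar> \<le> sqrt (?k\<^sup>2 * L)"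
      by (intro real_le_rsqrt) simp
    also have "\<dots> = ?k * sqrt L"
      using B by (simp add: real_sqrt_mult)
    also have "\<dots> \<le> \<bar>b - a\<bar> * (sqrt L * (B + 1)) "
      using B L by (simp add: mult.assoc mult_left_mono algebra_simps)
    also have "\<dots> < e"
    proof -
      have "\<bar>b - a\<bar> < e / (sqrt L * (B + 1))"
        using b by (simp add: \<delta>_def)
      moreover have "0 < sqrt L * (B + 1)"
        using B L by simp
      ultimately show ?thesis
        by (simp add: pos_less_divide_eq)
    qed
    finally show "\<bar>sol b s t - sol a s t\<bar> < e" .
  qed
qed

text \<open>The weight is the least one for which a zero lies in \<open>{c..s}\<close>. At an
  infimum the zero cannot yet have moved inside, so it sits at \<open>c\<close>.\<close>

lemma psi2_surj:
  assumes c: "c < s" and x: "c < x" "x < s" "0 < M x"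
  obtains a where "0 < a" "psi2 P Q M s a = ereal c"
proof -
  define S where "S = {a. 0 < a \<and> (\<exists>t\<in>{c..s}. sol a s t = 0)}"
  \<comment> \<open>A solution without zeros in the compact interval has a positive minimum there,
    which bounds the admissible perturbation. Hence the infimum of \<open>S\<close> has a zero
    itself.\<close>
  have open_pos: "\<exists>\<delta>>0. \<forall>b. \<bar>b - a\<bar> < \<delta> \<longrightarrow> b \<notin> S" if "\<forall>t\<in>{c..s}. sol a s t \<noteq> 0" for a
  proof -
    have pos: "0 < sol a s t" if "t \<in> {c..s}" for t
    proof (cases "t = c")
      case True
      have "\<not> sol a s c < 0"
        using IVT'[of "sol a s" c 0 s] c \<open>\<forall>t\<in>{c..s}. sol a s t \<noteq> 0\<close> sol_cont
        by (auto simp: sol_init)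
      then show ?thesis
        using True \<open>\<forall>t\<in>{c..s}. sol a s t \<noteq> 0\<close> that by (metis linorder_neqE_linordered_idom)
    next
      case False
      show ?thesis
        by (rule sol_pos_of_no_zero[of c]) (use that False \<open>\<forall>t\<in>{c..s}. sol a s t \<noteq> 0\<close> in auto)
    qed
    obtain x0 where x0: "x0 \<in> {c..s}" "\<And>t. t \<in> {c..s} \<Longrightarrow> sol a s x0 \<le> sol a s t"
      using continuous_attains_inf[OF compact_Icc _ sol_cont, of c s a s] c by auto
    obtain \<delta> where \<delta>: "0 < \<delta>" "\<And>b t. \<bar>b - a\<bar> < \<delta> \<Longrightarrow> t \<in> {c..s} \<Longrightarrow> \<bar>sol b s t - sol a s t\<bar> < sol a s x0"
      using sol_continuous_in_weight[OF pos[OF x0(1)], of a c s] by blast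
    have "sol b s t \<noteq> 0" if "\<bar>b - a\<bar> < \<delta>" "t \<in> {c..s}" for b t
      using \<delta>(2)[OF that] x0(2)[OF that(2)] by auto
    then show ?thesis
      using \<delta>(1) by (auto simp: S_def)
  qed
  have "S \<noteq> {}"
  proof -
    have "isCont M x"
      using M_cont by (simp add: continuous_on_eq_continuous_at)
    then obtain \<epsilon> where \<epsilon>: "0 < \<epsilon>" "\<And>t. \<bar>t - x\<bar> < \<epsilon> \<Longrightarrow> \<bar>M t - M x\<bar> < M x / 2"
      using x(3) by (auto simp: continuous_at_eps_delta dist_real_def dest: spec[of _ "M x / 2"])
    define d where "d = min (x + \<epsilon> / 2) s"
    have d: "x < d" "d \<le> s"
      using x \<epsilon> by (auto simp: d_def)
    have "M x / 2 \<le> M t" if "t \<in> {x..d}" for t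
      using \<epsilon>(2)[of t] \<epsilon>(1) that by (auto simp: d_def abs_if split: if_splits)
    then obtain A where "0 < A" "\<exists>t\<in>{x..d}. sol A s t = 0"
      using zero_for_large_weight[OF d(1), of "M x / 2"] x(3) by (metis half_gt_zero order_refl)
    then have "A \<in> S"
      using x d by (auto simp: S_def)
    then show ?thesis
      by blast
  qed
  have bdd: "bdd_below S"
    by (rule bdd_belowI[of _ 0]) (auto simp: S_def)
  define a where "a = Inf S"
  have a_ge: "0 \<le> a"
    unfolding a_def by (intro cInf_greatest \<open>S \<noteq> {}\<close>) (auto simp: S_def)
  have near: "\<exists>b\<in>S. \<bar>b - a\<bar> < \<delta>" if "0 < \<delta>" for \<delta>
  proof -
    obtain b where "b \<in> S" "b < a + \<delta>"
      using cInf_lessD[OF \<open>S \<noteq> {}\<close>, of "a + \<delta>"] \<open>0 < \<delta>\<close> by (auto simp: a_def)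
    moreover have "a \<le> b"
      unfolding a_def by (rule cInf_lower[OF \<open>b \<in> S\<close> bdd])
    ultimately show ?thesis
      by (intro bexI[of _ b]) auto
  qed
  have "\<exists>t\<in>{c..s}. sol a s t = 0"
    using open_pos[of a] near by blast
  then obtain t0 where t0: "t0 \<in> {c..s}" "sol a s t0 = 0"
    by blast
  then obtain c' where c': "t0 \<le> c'" "c' < s" "psi2 P Q M s a = ereal c'"
    using psi2_of_zero[OF t0(2)] by auto
  \<comment> \<open>The infimum is so far only known to be nonnegative; weight 0 admits no
    zero.\<close>
  obtain z where "0 < a * M z"
    by (rule psi2_weight_positive_somewhere[OF c'(3)])
  then have "0 < a"
    using a_ge by (cases "a = 0") auto
  have "c' = c"
  proof (rule ccontr)
    assume "c' \<noteq> c"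
    then have "c < c'"
      using c' t0 by auto
    have sc: "sol a s c' = 0" "\<And>t. c' < t \<Longrightarrow> t \<le> s \<Longrightarrow> 0 < sol a s t"
      using c'(3) by (auto simp: psi2_eq_iff)
    \<comment> \<open>By simplicity of the zero the solution is negative just left of
      \<open>c'\<close>. That negative value survives a slight decrease of the weight and gives an
      element of \<open>S\<close> below its infimum.\<close>
    have "0 < flux a s c' / P c'"
      using sol_pos_right_flux_pos[OF sc(1) c'(2)] sc(2) P_pos by simp
    then obtain e where e: "0 < e" "\<And>h. 0 < h \<Longrightarrow> h < e \<Longrightarrow> sol a s (c' - h) < sol a s c'"
      using DERIV_pos_inc_left[OF DERIV_sol] by blast
    define y where "y = c' - min (e / 2) (c' - c)"
    have y: "c \<le> y" "y < c'" "sol a s y < 0"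
      using e(2)[of "min (e / 2) (c' - c)"] e(1) \<open>c < c'\<close> sc(1) by (auto simp: y_def)
    obtain \<delta> where \<delta>: "0 < \<delta>"
      "\<And>b t. \<bar>b - a\<bar> < \<delta> \<Longrightarrow> t \<in> {c..s} \<Longrightarrow> \<bar>sol b s t - sol a s t\<bar> < - sol a s y"
      using sol_continuous_in_weight[of "- sol a s y" a c s] y(3) by auto
    define b where "b = a - min (\<delta> / 2) (a / 2)"
    have b: "0 < b" "b < a" "\<bar>b - a\<bar> < \<delta>"
      using \<delta>(1) \<open>0 < a\<close> by (auto simp: b_def min_def)
    have "sol b s y < 0"
      using \<delta>(2)[OF b(3), of y] y c'(2) by auto
    then have "\<exists>t\<ge>y. t \<le> s \<and> sol b s t = 0"
      using y c'(2) sol_cont by (intro IVT') (auto simp: sol_init)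
    then have "b \<in> S"
      using b y by (auto simp: S_def)
    then have "a \<le> b"
      unfolding a_def by (rule cInf_lower[OF _ bdd])
    then show False
      using b by simp
  qed
  then show ?thesis
    using that \<open>0 < a\<close> c'(3) by blast
qed

end

section \<open>Curves asymptotic to lines\<close>

lemma eventually_snd_to_infinity:
  "eventually F (snd_to_infinity C) \<longleftrightarrow> (\<exists>K. \<forall>x y. (x, y) \<in> C \<longrightarrow> K < \<bar>y\<bar> \<longrightarrow> F (x, y))"
  unfolding snd_to_infinity_def eventually_inf_principal eventually_filtercomap_at_top_dense
  by (simp add: split_paired_All) blast

text \<open>Exchanging the coordinates reduces one filter to the other, so limits need only be
  computed along \<open>snd_to_infinity\<close>.\<close>

lemma fst_to_infinity_swap:
  "fst_to_infinity C = filtermap prod.swap (snd_to_infinity (prod.swap ` C))"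
proof -
  have "eventually F (fst_to_infinity C) \<longleftrightarrow>
      eventually F (filtermap prod.swap (snd_to_infinity (prod.swap ` C)))" for F
    unfolding fst_to_infinity_def eventually_inf_principal eventually_filtercomap_at_top_dense
      eventually_filtermap eventually_snd_to_infinity
    by (simp add: split_paired_All) blast
  then show ?thesis
    by (simp add: filter_eq_iff)
qed

lemma asymptotic_to_lines_swap:
  "asymptotic_to_lines (prod.swap ` C) d c \<longleftrightarrow> asymptotic_to_lines C c d"
proof -
  have snd: "snd_to_infinity C = filtermap prod.swap (fst_to_infinity (prod.swap ` C))" for C
    unfolding fst_to_infinity_swap[of "prod.swap ` C"] filtermap_filtermap by (simp add: image_image)
  show ?thesis
    unfolding asymptotic_to_lines_def snd[of C] fst_to_infinity_swap[of C]
    by (auto simp: tendsto_def eventually_filtermap filtermap_bot_iff)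
qed

lemma asymptotic_to_the_lines_swap:
  assumes "asymptotic_to_the_lines C A B"
  shows "asymptotic_to_the_lines (prod.swap ` C) B A"
  using assms unfolding asymptotic_to_the_lines_def asymptotic_to_lines_swap by blast

lemma asymptotic_to_the_linesI:
  assumes "A c" "\<And>x. A x \<Longrightarrow> x = c" "B d" "\<And>y. B y \<Longrightarrow> y = d" "asymptotic_to_lines C c d"
  shows "asymptotic_to_the_lines C A B"
proof -
  have "(THE x. A x) = c" "(THE y. B y) = d"
    by (rule the_equality[where P = A, OF assms(1,2)] the_equality[where P = B, OF assms(3,4)], assumption)+
  moreover have "\<exists>!x. A x" "\<exists>!y. B y"
    by (rule ex1I[where P = A, OF assms(1,2)] ex1I[where P = B, OF assms(3,4)], assumption)+
  ultimately show ?thesis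
    using assms(5) by (simp add: asymptotic_to_the_lines_def)
qed

lemma snd_to_infinity_limit:
  assumes "\<And>K. \<exists>x y. (x, y) \<in> C \<and> K < \<bar>y\<bar>"
    and "\<And>e. 0 < e \<Longrightarrow> \<exists>K. \<forall>x y. (x, y) \<in> C \<longrightarrow> K < \<bar>y\<bar> \<longrightarrow> \<bar>x - c\<bar> < e"
  shows "snd_to_infinity C \<noteq> bot" "(fst \<longlongrightarrow> c) (snd_to_infinity C)"
proof -
  show "snd_to_infinity C \<noteq> bot"
  proof
    assume "snd_to_infinity C = bot"
    then have "eventually (\<lambda>_. False) (snd_to_infinity C)"
      by simp
    then show False
      using assms(1) unfolding eventually_snd_to_infinity by blast
  qed
  show "(fst \<longlongrightarrow> c) (snd_to_infinity C)"
    using assms(2) by (intro tendstoI) (simp add: eventually_snd_to_infinity dist_real_def)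
qed

text \<open>
  A curve \<open>{(s1 a, s2 b). A \<tau> a \<and> B \<tau> b}\<close> parametrised by \<open>\<tau> \<in> {i<..<j}\<close>, where \<open>A\<close> is an
  increasing bijection from \<open>{i..<j}\<close> onto an interval \<open>{\<alpha>..}\<close> and \<open>B\<close> a decreasing one from
  \<open>{i<..j}\<close> onto \<open>{\<beta>..}\<close>: one end of the curve is where \<open>\<tau>\<close> tends to \<open>i\<close>.
\<close>

lemma monotone_curve_end:
  fixes A B :: "real \<Rightarrow> real \<Rightarrow> bool" and s1 s2 :: real
  assumes A_fun: "\<And>\<tau> \<tau>' a. A \<tau> a \<Longrightarrow> A \<tau>' a \<Longrightarrow> \<tau> = \<tau>'"
    and A_mono: "\<And>\<tau> a a'. A \<tau> a \<Longrightarrow> a < a' \<Longrightarrow> \<exists>\<tau>'>\<tau>. A \<tau>' a'"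
    and A_surj: "\<And>\<tau>. i \<le> \<tau> \<Longrightarrow> \<tau> < j \<Longrightarrow> \<exists>a. A \<tau> a"
    and A_less: "\<And>\<tau> a. i \<le> \<tau> \<Longrightarrow> A \<tau> a \<Longrightarrow> \<tau> < j"
    and B_fun: "\<And>\<tau> \<tau>' b. B \<tau> b \<Longrightarrow> B \<tau>' b \<Longrightarrow> \<tau> = \<tau>'"
    and B_mono: "\<And>\<tau> b b'. B \<tau> b \<Longrightarrow> b < b' \<Longrightarrow> \<exists>\<tau>'<\<tau>. B \<tau>' b'"
    and B_surj: "\<And>\<tau>. i < \<tau> \<Longrightarrow> \<tau> \<le> j \<Longrightarrow> \<exists>b. B \<tau> b"
    and B_less: "\<And>\<tau> b. \<tau> \<le> j \<Longrightarrow> B \<tau> b \<Longrightarrow> i < \<tau>"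
    and B_pos: "\<And>\<tau> b. B \<tau> b \<Longrightarrow> 0 < b"
    and ends: "A i \<alpha>" "B j \<beta>" and s: "\<bar>s1\<bar> = 1" "\<bar>s2\<bar> = 1"
  defines "C \<equiv> {(s1 * a, s2 * b) | \<tau> a b. i < \<tau> \<and> \<tau> < j \<and> A \<tau> a \<and> B \<tau> b}"
  shows "snd_to_infinity C \<noteq> bot" "(fst \<longlongrightarrow> s1 * \<alpha>) (snd_to_infinity C)"
proof -
  have unbounded: "\<exists>x y. (x, y) \<in> C \<and> K < \<bar>y\<bar>" for K
  proof -
    \<comment> \<open>Being larger than \<open>\<beta>\<close> places the parameter of
      \<open>b\<close> strictly below \<open>j\<close>; being larger than \<open>K\<close> gives the
      unboundedness.\<close>
    define b where "b = max K \<beta> + 1"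
    have "\<beta> < b"
      by (simp add: b_def)
    then obtain \<tau> where \<tau>: "\<tau> < j" "B \<tau> b"
      using B_mono[OF ends(2)] by blast
    then have "i < \<tau>"
      using B_less[of \<tau> b] by simp
    then obtain a where "A \<tau> a"
      using A_surj[of \<tau>] \<tau> by auto
    then have "(s1 * a, s2 * b) \<in> C"
      using \<tau> \<open>i < \<tau>\<close> by (auto simp: C_def)
    moreover have "K < \<bar>s2 * b\<bar>"
    proof -
      have "K < b"
        by (simp add: b_def)
      then show ?thesis
        using s by (simp add: abs_mult)
    qed
    ultimately show ?thesis
      by blast
  qed
  have limit: "\<exists>K. \<forall>x y. (x, y) \<in> C \<longrightarrow> K < \<bar>y\<bar> \<longrightarrow> \<bar>x - s1 * \<alpha>\<bar> < e" if "0 < e" for e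
  proof -
    \<comment> \<open>The partner \<open>b0\<close> of \<open>\<alpha> + e / 2\<close> serves as
      threshold: a larger \<open>b\<close> means a smaller parameter, hence \<open>a\<close> between
      \<open>\<alpha>\<close> and \<open>\<alpha> + e / 2\<close>. Monotonicity and surjectivity
      thus stand in for continuity.\<close>
    obtain \<tau>0 where \<tau>0: "i < \<tau>0" "A \<tau>0 (\<alpha> + e / 2)"
      using A_mono[OF ends(1), of "\<alpha> + e / 2"] \<open>0 < e\<close> by auto
    have "\<tau>0 < j"
      using A_less[of \<tau>0] \<tau>0 by simp
    then obtain b0 where b0: "B \<tau>0 b0"
      using B_surj[of \<tau>0] \<tau>0 by auto
    have "\<bar>x - s1 * \<alpha>\<bar> < e" if C: "(x, y) \<in> C" "b0 < \<bar>y\<bar>" for x y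
    proof -
      obtain \<tau> a b where \<tau>: "i < \<tau>" "\<tau> < j" "A \<tau> a" "B \<tau> b" and x: "x = s1 * a" "y = s2 * b"
        using C by (auto simp: C_def)
      have "b0 < b"
        using C(2) s B_pos[OF \<tau>(4)] by (simp add: x abs_mult)
      then have "\<tau> < \<tau>0"
        using B_mono[OF b0] B_fun[OF \<tau>(4)] by blast
      then have "a \<le> \<alpha> + e / 2"
        using A_mono[OF \<tau>0(2), of a] A_fun[OF \<tau>(3)] by (metis less_asym not_le)
      moreover have "\<alpha> \<le> a"
        using A_mono[OF \<tau>(3), of \<alpha>] A_fun[OF ends(1)] \<tau>(1) by (metis less_asym not_le)
      ultimately have "\<bar>a - \<alpha>\<bar> < e"
        using \<open>0 < e\<close> by (simp add: abs_if)
      moreover have "\<bar>x - s1 * \<alpha>\<bar> = \<bar>s1\<bar> * \<bar>a - \<alpha>\<bar>"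
        unfolding x abs_mult[symmetric] by (simp add: right_diff_distrib)
      ultimately show ?thesis
        using s by simp
    qed
    then show ?thesis
      by blast
  qed
  show "snd_to_infinity C \<noteq> bot" "(fst \<longlongrightarrow> s1 * \<alpha>) (snd_to_infinity C)"
    by (rule snd_to_infinity_limit[OF unbounded limit], assumption)+
qed

text \<open>The other end is the same statement for the curve run backwards: \<open>\<tau>\<close>
  becomes \<open>- \<tau>\<close>, \<open>A\<close> and \<open>B\<close> trade places, and the
  coordinates are swapped.\<close>

lemma monotone_curve_asymptotic:
  fixes A B :: "real \<Rightarrow> real \<Rightarrow> bool" and s1 s2 :: real
  assumes A_fun: "\<And>\<tau> \<tau>' a. A \<tau> a \<Longrightarrow> A \<tau>' a \<Longrightarrow> \<tau> = \<tau>'"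
    and A_mono: "\<And>\<tau> a a'. A \<tau> a \<Longrightarrow> a < a' \<Longrightarrow> \<exists>\<tau>'>\<tau>. A \<tau>' a'"
    and A_surj: "\<And>\<tau>. i \<le> \<tau> \<Longrightarrow> \<tau> < j \<Longrightarrow> \<exists>a. A \<tau> a"
    and A_less: "\<And>\<tau> a. i \<le> \<tau> \<Longrightarrow> A \<tau> a \<Longrightarrow> \<tau> < j"
    and A_pos: "\<And>\<tau> a. A \<tau> a \<Longrightarrow> 0 < a"
    and B_fun: "\<And>\<tau> \<tau>' b. B \<tau> b \<Longrightarrow> B \<tau>' b \<Longrightarrow> \<tau> = \<tau>'"
    and B_mono: "\<And>\<tau> b b'. B \<tau> b \<Longrightarrow> b < b' \<Longrightarrow> \<exists>\<tau>'<\<tau>. B \<tau>' b'"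
    and B_surj: "\<And>\<tau>. i < \<tau> \<Longrightarrow> \<tau> \<le> j \<Longrightarrow> \<exists>b. B \<tau> b"
    and B_less: "\<And>\<tau> b. \<tau> \<le> j \<Longrightarrow> B \<tau> b \<Longrightarrow> i < \<tau>"
    and B_pos: "\<And>\<tau> b. B \<tau> b \<Longrightarrow> 0 < b"
    and ends: "A i \<alpha>" "B j \<beta>" and s: "\<bar>s1\<bar> = 1" "\<bar>s2\<bar> = 1"
  shows "asymptotic_to_lines {(s1 * a, s2 * b) | \<tau> a b. i < \<tau> \<and> \<tau> < j \<and> A \<tau> a \<and> B \<tau> b}
    (s1 * \<alpha>) (s2 * \<beta>)"
proof -
  let ?C = "{(s1 * a, s2 * b) | \<tau> a b. i < \<tau> \<and> \<tau> < j \<and> A \<tau> a \<and> B \<tau> b}"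
  let ?D = "{(s2 * b, s1 * a) | \<tau> b a. - j < \<tau> \<and> \<tau> < - i \<and> B (- \<tau>) b \<and> A (- \<tau>) a}"
  have 1: "snd_to_infinity ?C \<noteq> bot" "(fst \<longlongrightarrow> s1 * \<alpha>) (snd_to_infinity ?C)"
    by (rule monotone_curve_end[where A = A and B = B, OF A_fun A_mono A_surj A_less B_fun B_mono
          B_surj B_less B_pos ends s]; assumption)+
  have 2: "snd_to_infinity ?D \<noteq> bot" "(fst \<longlongrightarrow> s2 * \<beta>) (snd_to_infinity ?D)"
  proof -
    have nA_fun: "\<tau> = \<tau>'" if "A (- \<tau>) a" "A (- \<tau>') a" for \<tau> \<tau>' a
      using A_fun[OF that] by simp
    have nB_fun: "\<tau> = \<tau>'" if "B (- \<tau>) b" "B (- \<tau>') b" for \<tau> \<tau>' b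
      using B_fun[OF that] by simp
    have nA_mono: "\<exists>\<tau>'<\<tau>. A (- \<tau>') a'" if "A (- \<tau>) a" "a < a'" for \<tau> a a'
      using A_mono[OF that] by (metis minus_minus neg_less_iff_less)
    have nB_mono: "\<exists>\<tau>'>\<tau>. B (- \<tau>') b'" if "B (- \<tau>) b" "b < b'" for \<tau> b b'
      using B_mono[OF that] by (metis minus_minus neg_less_iff_less)
    have nA_less: "- j < \<tau>" if "\<tau> \<le> - i" "A (- \<tau>) a" for \<tau> a
      using A_less[of "- \<tau>" a] that by simp
    have nB_less: "\<tau> < - i" if "- j \<le> \<tau>" "B (- \<tau>) b" for \<tau> b
      using B_less[of "- \<tau>" b] that by simp
    have nA_surj: "\<exists>a. A (- \<tau>) a" if "- j < \<tau>" "\<tau> \<le> - i" for \<tau>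
      using A_surj[of "- \<tau>"] that by simp
    have nB_surj: "\<exists>b. B (- \<tau>) b" if "- j \<le> \<tau>" "\<tau> < - i" for \<tau>
      using B_surj[of "- \<tau>"] that by simp
    show "snd_to_infinity ?D \<noteq> bot" "(fst \<longlongrightarrow> s2 * \<beta>) (snd_to_infinity ?D)"
      by (rule monotone_curve_end[where A = "\<lambda>\<tau>. B (- \<tau>)" and B = "\<lambda>\<tau>. A (- \<tau>)" and i = "- j" and j = "- i",
            OF nB_fun nB_mono nB_surj nB_less nA_fun nA_mono nA_surj nA_less A_pos];
          use ends s in simp; fail)+
  qed
  have "prod.swap ` ?C = ?D"
  proof (intro set_eqI iffI)
    fix z assume "z \<in> prod.swap ` ?C"
    then obtain y where y: "y \<in> ?C" "z = prod.swap y"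
      by blast
    then obtain \<tau> a b where "y = (s1 * a, s2 * b)" "i < \<tau>" "\<tau> < j" "A \<tau> a" "B \<tau> b"
      by blast
    then show "z \<in> ?D"
      by (intro CollectI exI[of _ "- \<tau>"] exI[of _ b] exI[of _ a]) (auto simp: y)
  next
    fix z assume "z \<in> ?D"
    then obtain \<tau> a b where z: "z = (s2 * b, s1 * a)" "- j < \<tau>" "\<tau> < - i" "A (- \<tau>) a" "B (- \<tau>) b"
      by blast
    then have "z = prod.swap (s1 * a, s2 * b)"
      by simp
    moreover have "(s1 * a, s2 * b) \<in> ?C"
      using z by (intro CollectI exI[of _ "- \<tau>"] exI[of _ a] exI[of _ b]) auto
    ultimately show "z \<in> prod.swap ` ?C"
      by (rule image_eqI)
  qed
  then have "fst_to_infinity ?C = filtermap prod.swap (snd_to_infinity ?D)"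
    by (simp add: fst_to_infinity_swap)
  then show ?thesis
    using 1 2 by (simp add: asymptotic_to_lines_def filtermap_bot_iff filterlim_filtermap o_def tendsto_def eventually_filtermap)
qed

section \<open>Reflection and the other zero-function\<close>

text \<open>Only the product of weight and \<open>M\<close> enters the equation, so the sign of a
  weight can be moved into \<open>M\<close>; negative weights reduce to positive ones.\<close>

lemma psi2_scale: "psi2 P Q (\<lambda>t. k * M t) s a = psi2 P Q M s (a * k)"
  by (simp add: psi2_def sol_v_def mult.assoc)

lemma psi1_scale: "psi1 P Q (\<lambda>t. k * M t) s a = psi1 P Q M s (a * k)"
  by (simp add: psi1_def sol_v_def mult.assoc)

context sl_coeffs
begin

lemma sl_coeffs_scale: "sl_coeffs P Q (\<lambda>t. k * M t) p1 p2 q2"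
  using P_cont Q_cont M_cont p1_pos P_ge P_le Q_nonneg Q_le
  by unfold_locales (auto intro: continuous_intros)

lemma sl_coeffs_reflect: "sl_coeffs (\<lambda>t. P (- t)) (\<lambda>t. Q (- t)) (\<lambda>t. M (- t)) p1 p2 q2"
proof -
  have "continuous_on UNIV (\<lambda>t. f (- t))" if "continuous_on UNIV f" for f :: "real \<Rightarrow> real"
    by (rule continuous_on_compose2[OF that]) (auto intro: continuous_intros)
  then show ?thesis
    using P_cont Q_cont M_cont p1_pos P_ge P_le Q_nonneg Q_le by unfold_locales auto
qed

lemma sol_unique:
  assumes "v s = 1" "w s = 0" "\<And>t. (v has_real_derivative w t / P t) (at t)"
    "\<And>t. (w has_real_derivative (Q t - a * M t) * v t) (at t)"
  shows "v t = sol a s t"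
proof -
  have "sl_pair P (\<lambda>t. Q t - a * M t) (\<lambda>_. 0) c d v w" for c d
    using assms(3,4) continuous_on_of_DERIV[OF assms(3)] continuous_on_of_DERIV[OF assms(4)]
    by (auto simp: sl_pair_def)
  then show ?thesis
    using sl_pair_unique(1)[of P "\<lambda>t. Q t - a * M t" "min s t" "max s t" v w "sol a s" "flux a s" p1 s 1 t,
        OF _ sl_pair_sol P_ge p1_pos R_cont]
    by (auto simp: assms(1,2) sol_init flux_init)
qed

text \<open>Reflection reverses the first derivative but not the second-order term, so the reflected
  flux is \<open>- flux a s (- t)\<close>.\<close>

lemma sol_reflect:
  "sol_v (\<lambda>t. P (- t)) (\<lambda>t. Q (- t)) (\<lambda>t. M (- t)) a (- s) t = sol a s (- t)"
proof -
  interpret r: sl_coeffs "\<lambda>t. P (- t)" "\<lambda>t. Q (- t)" "\<lambda>t. M (- t)" p1 p2 q2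
    by (rule sl_coeffs_reflect)
  have d: "((\<lambda>t. f (- t)) has_real_derivative - D) (at t)"
    if "(f has_real_derivative D) (at (- t))" for f :: "real \<Rightarrow> real" and D t
    using DERIV_chain2[of f D uminus t "- 1" UNIV, OF that DERIV_minus[OF DERIV_ident]] by simp
  have "sol a s (- t) = r.sol a (- s) t"
  proof (rule r.sol_unique[where w = "\<lambda>t. - flux a s (- t)"])
    fix t
    show "((\<lambda>t. sol a s (- t)) has_real_derivative - flux a s (- t) / P (- t)) (at t)"
      using d[OF DERIV_sol] by simp
    show "((\<lambda>t. - flux a s (- t)) has_real_derivative (Q (- t) - a * M (- t)) * sol a s (- t)) (at t)"
      using DERIV_minus[OF d[OF DERIV_flux]] by simp
  qed (auto simp: sol_init flux_init)
  then show ?thesis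
    by simp
qed

lemma psi1_reflect:
  "psi1 P Q M s a = - psi2 (\<lambda>t. P (- t)) (\<lambda>t. Q (- t)) (\<lambda>t. M (- t)) (- s) a"
proof -
  have "ereal ` {t. t < - s \<and> sol a s (- t) = 0} = uminus ` ereal ` {t. s < t \<and> sol a s t = 0}"
    by (force simp: image_iff intro: bexI[of _ "- _"])
  then show ?thesis
    by (simp add: psi1_def psi2_def sol_reflect ereal_Sup_uminus_image_eq)
qed

lemma psi1_eq_reflect:
  "psi1 P Q M s a = ereal c \<longleftrightarrow>
    psi2 (\<lambda>t. P (- t)) (\<lambda>t. Q (- t)) (\<lambda>t. M (- t)) (- s) a = ereal (- c)"
  unfolding psi1_reflect by (metis ereal_uminus_uminus uminus_ereal.simps(1))

lemma psi1_eq_iff: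
  "psi1 P Q M s a = ereal c \<longleftrightarrow> s < c \<and> sol a s c = 0 \<and> (\<forall>t. s \<le> t \<longrightarrow> t < c \<longrightarrow> 0 < sol a s t)"
proof -
  interpret r: sl_coeffs "\<lambda>t. P (- t)" "\<lambda>t. Q (- t)" "\<lambda>t. M (- t)" p1 p2 q2
    by (rule sl_coeffs_reflect)
  show ?thesis
    unfolding psi1_eq_reflect r.psi2_eq_iff sol_reflect
    by (auto, metis minus_le_iff minus_minus neg_less_iff_less)
qed

lemma psi2_eqI:
  assumes "c < s" "sol a s c = 0" "\<And>t. c < t \<Longrightarrow> t < s \<Longrightarrow> sol a s t \<noteq> 0"
  shows "psi2 P Q M s a = ereal c"
  using assms sol_pos_of_no_zero unfolding psi2_eq_iff by blast

lemma psi1_eqI: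
  assumes "s < c" "sol a s c = 0" "\<And>t. s < t \<Longrightarrow> t < c \<Longrightarrow> sol a s t \<noteq> 0"
  shows "psi1 P Q M s a = ereal c"
proof -
  interpret r: sl_coeffs "\<lambda>t. P (- t)" "\<lambda>t. Q (- t)" "\<lambda>t. M (- t)" p1 p2 q2
    by (rule sl_coeffs_reflect)
  show ?thesis
    unfolding psi1_eq_reflect by (rule r.psi2_eqI) (auto simp: sol_reflect assms)
qed

lemma sol_pos_left_flux_neg:
  assumes "sol a s c = 0" "d < c" "\<And>t. d < t \<Longrightarrow> t < c \<Longrightarrow> 0 < sol a s t"
  shows "flux a s c < 0"
proof (rule ccontr)
  assume "\<not> flux a s c < 0"
  then have "0 < flux a s c / P c"
    using flux_nonzero[OF assms(1)] P_pos[of c] by simp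
  then obtain e where e: "0 < e" "\<And>h. 0 < h \<Longrightarrow> h < e \<Longrightarrow> sol a s (c - h) < sol a s c"
    using DERIV_pos_inc_left[OF DERIV_sol] by blast
  have "sol a s (c - min (e / 2) ((c - d) / 2)) < sol a s c"
    using e(1) assms(2) by (intro e(2)) auto
  moreover have "0 < sol a s (c - min (e / 2) ((c - d) / 2))"
    using e(1) assms(2) by (intro assms(3)) (auto simp: min_def field_simps)
  ultimately show False
    using assms(1) by simp
qed

lemma psi1_strict_mono:
  assumes "0 < a" "a < a'" "psi1 P Q M s a = ereal c"
  obtains c' where "c' < c" "psi1 P Q M s a' = ereal c'"
proof -
  interpret r: sl_coeffs "\<lambda>t. P (- t)" "\<lambda>t. Q (- t)" "\<lambda>t. M (- t)" p1 p2 q2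
    by (rule sl_coeffs_reflect)
  obtain c' where "- c < c'" "psi2 (\<lambda>t. P (- t)) (\<lambda>t. Q (- t)) (\<lambda>t. M (- t)) (- s) a' = ereal c'"
    using assms(3) r.psi2_strict_mono[OF assms(1,2)] unfolding psi1_eq_reflect by blast
  then show ?thesis
    by (intro that[of "- c'"]) (auto simp: psi1_eq_reflect)
qed

lemma psi1_surj:
  assumes "s < c" "s < x" "x < c" "0 < M x"
  obtains a where "0 < a" "psi1 P Q M s a = ereal c"
proof -
  interpret r: sl_coeffs "\<lambda>t. P (- t)" "\<lambda>t. Q (- t)" "\<lambda>t. M (- t)" p1 p2 q2
    by (rule sl_coeffs_reflect)
  obtain a where "0 < a" "psi2 (\<lambda>t. P (- t)) (\<lambda>t. Q (- t)) (\<lambda>t. M (- t)) (- s) a = ereal (- c)"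
    by (rule r.psi2_surj[of "- c" "- s" "- x"]) (use assms in auto)
  then show ?thesis
    using that by (simp add: psi1_eq_reflect)
qed

lemma psi1_weight_positive_somewhere:
  assumes "psi1 P Q M s a = ereal c"
  obtains t where "s < t" "t < c" "0 < a * M t"
proof -
  interpret r: sl_coeffs "\<lambda>t. P (- t)" "\<lambda>t. Q (- t)" "\<lambda>t. M (- t)" p1 p2 q2
    by (rule sl_coeffs_reflect)
  obtain t where "- c < t" "t < - s" "0 < a * M (- t)"
    using r.psi2_weight_positive_somewhere assms unfolding psi1_eq_reflect by blast
  then show ?thesis
    by (intro that[of "- t"]) auto
qed

end

section \<open>Solutions with one interior zero\<close>

text \<open>At \<open>\<tau>\<close> the one-sided derivatives coincide, and the two closed
  half-lines cover the line.\<close>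

lemma DERIV_If_glue:
  fixes f g :: "real \<Rightarrow> real"
  assumes f: "\<And>t. (f has_real_derivative f' t) (at t)" and g: "\<And>t. (g has_real_derivative g' t) (at t)"
    and eq: "f \<tau> = g \<tau>" "f' \<tau> = g' \<tau>"
  shows "((\<lambda>t. if \<tau> \<le> t then f t else g t) has_real_derivative (if \<tau> \<le> t then f' t else g' t)) (at t)"
proof -
  let ?F = "\<lambda>t. if \<tau> \<le> t then f t else g t"
  consider "\<tau> < t" | "t < \<tau>" | "t = \<tau>"
    by linarith
  then show ?thesis
  proof cases
    case 1
    then show ?thesis
      using has_field_derivative_transform_within_open[OF f[of t], of "{\<tau><..}" ?F] by auto
  next
    case 2
    then show ?thesis
      using has_field_derivative_transform_within_open[OF g[of t], of "{..<\<tau>}" ?F] by auto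
  next
    case 3
    have "(?F has_real_derivative f' \<tau>) (at \<tau> within {\<tau>..})"
      by (rule has_field_derivative_transform_within[OF has_field_derivative_at_within[OF f] zero_less_one]) auto
    moreover have "(?F has_real_derivative f' \<tau>) (at \<tau> within {..\<tau>})"
      unfolding eq(2)
      by (rule has_field_derivative_transform_within[OF has_field_derivative_at_within[OF g] zero_less_one])
        (use eq in auto)
    ultimately have "(?F has_real_derivative f' \<tau>) (at \<tau> within ({..\<tau>} \<union> {\<tau>..}))"
      unfolding has_field_derivative_iff by (simp add: Lim_within_Un)
    moreover have "{..\<tau>} \<union> {\<tau>..} = (UNIV :: real set)"
      by auto
    ultimately show ?thesis
      using 3 by simp
  qed
qed

lemma constant_sign_of_no_zero:
  fixes f :: "real \<Rightarrow> real"
  assumes "continuous_on {c..d} f" "\<And>t. t \<in> {c..d} \<Longrightarrow> f t \<noteq> 0" "x \<in> {c..d}" "y \<in> {c..d}" "0 < f x"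
  shows "0 < f y"
proof (rule ccontr)
  assume "\<not> 0 < f y"
  have "connected (f ` {c..d})"
    by (intro connected_continuous_image assms(1)) auto
  then have "0 \<in> f ` {c..d}"
    by (rule connectedD_interval[of _ "f y" "f x"]) (use assms \<open>\<not> 0 < f y\<close> in auto)
  then show False
    using assms(2) by auto
qed

context sl_coeffs
begin

text \<open>Passes to the flux and to the extended coefficients. Agreement on
  \<open>{T1..T2}\<close> suffices because the flux equation is imposed only at interior points, and
  \<open>0 < P\<close> matches the two forms of the boundary condition.\<close>

lemma solves_P_iff_flux:
  assumes agree: "\<forall>t\<in>{T1..T2}. P t = p t \<and> Q t = q t \<and> M t = m t"
  shows "solves_P p q m T1 T2 a b u \<longleftrightarrow>
    (\<exists>w. (\<forall>t\<in>{T1..T2}. (u has_real_derivative w t / P t) (at t within {T1..T2})) \<and>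
         continuous_on {T1..T2} w \<and>
         (\<forall>t\<in>{T1<..<T2}. (w has_real_derivative
             Q t * u t - M t * (a * max (u t) 0 - b * max (- u t) 0)) (at t)) \<and>
         w T1 = 0 \<and> w T2 = 0)"
    (is "_ \<longleftrightarrow> (\<exists>w. ?W w)")
proof -
  have agree': "P t = p t" "Q t = q t" "M t = m t" if "t \<in> {T1<..<T2}" for t
    using agree that by auto
  show ?thesis
  proof
    assume "solves_P p q m T1 T2 a b u"
    then obtain du where du: "\<forall>t\<in>{T1..T2}. (u has_real_derivative du t) (at t within {T1..T2})"
      "continuous_on {T1..T2} du" "du T1 = 0" "du T2 = 0"
      and sl: "solves_SL p q (\<lambda>t x. m t * (a * max x 0 - b * max (- x) 0)) {T1<..<T2} u du"
      by (auto simp: solves_P_def)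
    have "?W (\<lambda>t. P t * du t)"
    proof (intro conjI ballI)
      show "(u has_real_derivative P t * du t / P t) (at t within {T1..T2})" if "t \<in> {T1..T2}" for t
        using du(1) that P_pos[of t] by simp
      show "continuous_on {T1..T2} (\<lambda>t. P t * du t)"
        by (intro continuous_intros du(2) continuous_on_subset[OF P_cont]) auto
      fix t assume t: "t \<in> {T1<..<T2}"
      then have "((\<lambda>s. p s * du s) has_real_derivative
          q t * u t - m t * (a * max (u t) 0 - b * max (- u t) 0)) (at t)"
        using sl by (auto simp: solves_SL_def)
      then have "((\<lambda>s. P s * du s) has_real_derivative
          q t * u t - m t * (a * max (u t) 0 - b * max (- u t) 0)) (at t)"
        by (rule has_field_derivative_transform_within_open[of _ _ _ "{T1<..<T2}"]) (use t in \<open>simp_all add: agree'\<close>)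
      then show "((\<lambda>s. P s * du s) has_real_derivative
          Q t * u t - M t * (a * max (u t) 0 - b * max (- u t) 0)) (at t)"
        using agree'[of t] t by simp
    qed (use du in auto)
    then show "\<exists>w. ?W w"
      by (rule exI[where P = ?W])
  next
    assume "\<exists>w. ?W w"
    then obtain w where w: "?W w"
      by blast
    show "solves_P p q m T1 T2 a b u"
      unfolding solves_P_def
    proof (intro exI[of _ "\<lambda>t. w t / P t"] conjI)
      show "continuous_on {T1..T2} (\<lambda>t. w t / P t)"
        using w P_pos by (intro continuous_intros continuous_on_subset[OF P_cont]) (auto simp: less_le)
      show "solves_SL p q (\<lambda>t x. m t * (a * max x 0 - b * max (- x) 0)) {T1<..<T2} u (\<lambda>t. w t / P t)"
        unfolding solves_SL_def
      proof (intro ballI conjI)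
        fix t assume t: "t \<in> {T1<..<T2}"
        then have "(u has_real_derivative w t / P t) (at t within {T1..T2})"
          using w by auto
        then show "(u has_real_derivative w t / P t) (at t)"
          using t at_within_interior[of t "{T1..T2}"] by simp
        have "(w has_real_derivative Q t * u t - M t * (a * max (u t) 0 - b * max (- u t) 0)) (at t)"
          using w t by blast
        then have "((\<lambda>s. p s * (w s / P s)) has_real_derivative
            Q t * u t - M t * (a * max (u t) 0 - b * max (- u t) 0)) (at t)"
        proof (rule has_field_derivative_transform_within_open[of _ _ _ "{T1<..<T2}"])
          fix s assume "s \<in> {T1<..<T2}"
          then show "w s = p s * (w s / P s)"
            using agree'(1) P_pos[of s] by simp
        qed (use t in auto)
        then show "((\<lambda>s. p s * (w s / P s)) has_real_derivative
            q t * u t - m t * (a * max (u t) 0 - b * max (- u t) 0)) (at t)"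
          using agree'[OF t] by simp
      qed
    qed (use w in auto)
  qed
qed

text \<open>The sign at \<open>T2\<close> fixes the sign of the right piece, which therefore solves
  the linear equation with weight \<open>a\<close>. Simplicity of its zero then forces a change of
  sign, so the left piece is negative and carries the weight \<open>b\<close>.\<close>

lemma C1_gt_imp_psi:
  assumes agree: "\<forall>t\<in>{T1..T2}. P t = p t \<and> Q t = q t \<and> M t = m t"
    and C1: "(a, b) \<in> C1_gt p q m T1 T2"
  obtains \<tau> where "T1 < \<tau>" "\<tau> < T2" "psi2 P Q M T2 a = ereal \<tau>" "psi1 P Q M T1 b = ereal \<tau>"
proof -
  obtain u where u: "solves_P p q m T1 T2 a b u" "\<exists>!t. t \<in> {T1<..<T2} \<and> u t = 0" "0 < u T2"
    using C1 by (auto simp: C1_gt_def)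
  obtain w where du: "\<forall>t\<in>{T1..T2}. (u has_real_derivative w t / P t) (at t within {T1..T2})"
    and w_cont: "continuous_on {T1..T2} w"
    and dw: "\<forall>t\<in>{T1<..<T2}. (w has_real_derivative
             Q t * u t - M t * (a * max (u t) 0 - b * max (- u t) 0)) (at t)"
    and w0: "w T1 = 0" "w T2 = 0"
    using u(1) unfolding solves_P_iff_flux[OF agree] by blast
  obtain \<tau> where \<tau>: "T1 < \<tau>" "\<tau> < T2" "u \<tau> = 0"
    and nz: "\<And>t. T1 < t \<Longrightarrow> t < T2 \<Longrightarrow> t \<noteq> \<tau> \<Longrightarrow> u t \<noteq> 0"
    using u(2) by auto
  have u_cont: "continuous_on {T1..T2} u"
    using du by (intro DERIV_continuous_on) auto
  have du': "(u has_real_derivative w t / P t) (at t)" if "T1 < t" "t < T2" for t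
  proof -
    have "(u has_real_derivative w t / P t) (at t within {T1..T2})"
      using du that by auto
    then show ?thesis
      using that at_within_interior[of t "{T1..T2}"] by simp
  qed
  have sl_pos: "sl_pair P (\<lambda>t. Q t - a * M t) (\<lambda>_. 0) c d u w"
    if "T1 \<le> c" "d \<le> T2" "\<And>t. c < t \<Longrightarrow> t < d \<Longrightarrow> 0 < u t" for c d
    unfolding sl_pair_def
  proof (intro conjI ballI)
    fix t assume t: "t \<in> {c<..<d}"
    then show "(u has_real_derivative w t / P t) (at t)"
      using du' that by auto
    have "0 < u t" "t \<in> {T1<..<T2}"
      using that t by auto
    then show "(w has_real_derivative (Q t - a * M t) * u t + 0) (at t)"
      using bspec[OF dw, of t] by (simp add: algebra_simps)
  qed (use that u_cont w_cont in \<open>auto intro: continuous_on_subset\<close>)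
  have sl_neg: "sl_pair P (\<lambda>t. Q t - b * M t) (\<lambda>_. 0) c d u w"
    if "T1 \<le> c" "d \<le> T2" "\<And>t. c < t \<Longrightarrow> t < d \<Longrightarrow> u t < 0" for c d
    unfolding sl_pair_def
  proof (intro conjI ballI)
    fix t assume t: "t \<in> {c<..<d}"
    then show "(u has_real_derivative w t / P t) (at t)"
      using du' that by auto
    have "u t < 0" "t \<in> {T1<..<T2}"
      using that t by auto
    then show "(w has_real_derivative (Q t - b * M t) * u t + 0) (at t)"
      using bspec[OF dw, of t] by (simp add: algebra_simps)
  qed (use that u_cont w_cont in \<open>auto intro: continuous_on_subset\<close>)
  have right: "0 < u t" if "\<tau> < t" "t \<le> T2" for t
  proof (rule constant_sign_of_no_zero[where c = t and d = T2 and f = u and x = T2])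
    show "continuous_on {t..T2} u"
      using u_cont by (rule continuous_on_subset) (use that \<tau> in auto)
    show "u s \<noteq> 0" if "s \<in> {t..T2}" for s
      using nz[of s] u(3) that \<open>\<tau> < t\<close> \<tau> by (cases "s = T2") auto
  qed (use that u(3) in auto)
  have u_right: "u t = u T2 * sol a T2 t" "w t = u T2 * flux a T2 t" if "t \<in> {\<tau>..T2}" for t
    using sl_pair_unique[OF sl_pos sl_pair_sol P_ge p1_pos R_cont, of \<tau> T2 T2 "u T2" T2 t]
      that right \<tau> by (auto simp: sol_init flux_init w0)
  have psi2: "psi2 P Q M T2 a = ereal \<tau>"
  proof (rule psi2_eqI)
    show "sol a T2 \<tau> = 0"
      using u_right(1)[of \<tau>] \<tau> u(3) by auto
    show "sol a T2 t \<noteq> 0" if "\<tau> < t" "t < T2" for t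
      using u_right(1)[of t] right[of t] that by auto
  qed (use \<tau> in auto)
  \<comment> \<open>A single zero could be a touching point; the positive flux excludes this and
    gives a negative value at some \<open>y\<close> left of \<open>\<tau>\<close>.\<close>
  have "0 < flux a T2 \<tau>"
    by (rule sol_pos_right_flux_pos[of _ _ _ T2]) (use psi2 in \<open>auto simp: psi2_eq_iff\<close>)
  then have "0 < w \<tau> / P \<tau>"
    using u_right(2)[of \<tau>] \<tau> u(3) P_pos by simp
  then obtain e where e: "0 < e" "\<And>h. 0 < h \<Longrightarrow> h < e \<Longrightarrow> u (\<tau> - h) < u \<tau>"
    using DERIV_pos_inc_left[OF du'[OF \<tau>(1,2)]] by blast
  define y where "y = \<tau> - min (e / 2) ((\<tau> - T1) / 2)"
  have y: "T1 < y" "y < \<tau>" "u y < 0"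
    using e(2)[of "min (e / 2) ((\<tau> - T1) / 2)"] e(1) \<tau> by (auto simp: y_def min_def field_simps)
  have left: "u t < 0" if "T1 < t" "t < \<tau>" for t
  proof -
    have "0 < - u t"
    proof (rule constant_sign_of_no_zero[where c = "min t y" and d = "max t y" and f = "\<lambda>t. - u t" and x = y])
      show "continuous_on {min t y..max t y} (\<lambda>t. - u t)"
        by (intro continuous_intros continuous_on_subset[OF u_cont]) (use that \<tau> y in auto)
      show "- u s \<noteq> 0" if "s \<in> {min t y..max t y}" for s
      proof -
        have "T1 < s" "s < \<tau>"
          using that \<open>T1 < t\<close> \<open>t < \<tau>\<close> y by auto
        then show ?thesis
          using nz[of s] \<tau> by auto
      qed
    qed (use y in auto)
    then show ?thesis
      by simp
  qed
  have u_left: "u t = u T1 * sol b T1 t" if "t \<in> {T1..\<tau>}" for t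
    using sl_pair_unique(1)[OF sl_neg sl_pair_sol P_ge p1_pos R_cont, of T1 \<tau> T1 "u T1" T1 t]
      that left \<tau> by (auto simp: sol_init flux_init w0)
  \<comment> \<open>The condition on zeros concerns the open interval only, so the value at
    \<open>T1\<close> is controlled through the proportionality and \<open>u y < 0\<close>.\<close>
  have "u T1 \<noteq> 0"
    using u_left[of y] y by auto
  have "psi1 P Q M T1 b = ereal \<tau>"
  proof (rule psi1_eqI)
    show "sol b T1 \<tau> = 0"
      using u_left[of \<tau>] \<tau> \<open>u T1 \<noteq> 0\<close> by auto
    show "sol b T1 t \<noteq> 0" if "T1 < t" "t < \<tau>" for t
      using u_left[of t] left[of t] that by auto
  qed (use \<tau> in auto)
  then show ?thesis
    using that \<tau> psi2 by blast
qed

lemma psi_imp_C1_gt: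
  assumes agree: "\<forall>t\<in>{T1..T2}. P t = p t \<and> Q t = q t \<and> M t = m t"
    and psi2: "psi2 P Q M T2 a = ereal \<tau>" and psi1: "psi1 P Q M T1 b = ereal \<tau>"
  shows "(a, b) \<in> C1_gt p q m T1 T2"
proof -
  have right: "\<tau> < T2" "sol a T2 \<tau> = 0" "\<And>t. \<tau> < t \<Longrightarrow> t \<le> T2 \<Longrightarrow> 0 < sol a T2 t"
    using psi2 by (auto simp: psi2_eq_iff)
  have left: "T1 < \<tau>" "sol b T1 \<tau> = 0" "\<And>t. T1 \<le> t \<Longrightarrow> t < \<tau> \<Longrightarrow> 0 < sol b T1 t"
    using psi1 by (auto simp: psi1_eq_iff)
  have w2: "0 < flux a T2 \<tau>"
    by (rule sol_pos_right_flux_pos[of _ _ _ T2]) (use right in auto)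
  have w1: "flux b T1 \<tau> < 0"
    by (rule sol_pos_left_flux_neg[of _ _ _ T1]) (use left in auto)
  \<comment> \<open>This factor matches the fluxes at \<open>\<tau>\<close>. The fluxes have
    opposite signs, so it also makes the left piece negative.\<close>
  define k where "k = flux a T2 \<tau> / flux b T1 \<tau>"
  have k: "k < 0" "k * flux b T1 \<tau> = flux a T2 \<tau>"
    using w1 w2 by (auto simp: k_def divide_pos_neg)
  define u where "u t = (if \<tau> \<le> t then sol a T2 t else k * sol b T1 t)" for t
  define w where "w t = (if \<tau> \<le> t then flux a T2 t else k * flux b T1 t)" for t
  have du: "(u has_real_derivative w t / P t) (at t)" for t
  proof -
    have "(u has_real_derivative (if \<tau> \<le> t then flux a T2 t / P t else k * (flux b T1 t / P t))) (at t)"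
      unfolding u_def[abs_def]
      by (rule DERIV_If_glue[OF DERIV_sol DERIV_cmult[OF DERIV_sol]]) (use right left k in auto)
    then show ?thesis
      by (auto simp: w_def split: if_splits)
  qed
  \<comment> \<open>The derivatives of the two fluxes agree at \<open>\<tau>\<close>, although
    \<open>a\<close> and \<open>b\<close> may differ, because both solutions vanish there.\<close>
  have dw: "(w has_real_derivative (if \<tau> \<le> t then (Q t - a * M t) * sol a T2 t
      else k * ((Q t - b * M t) * sol b T1 t))) (at t)" for t
    unfolding w_def[abs_def]
    by (rule DERIV_If_glue[OF DERIV_flux DERIV_cmult[OF DERIV_flux]]) (use right left k in auto)
  have pos: "0 < u t" if "\<tau> < t" "t \<le> T2" for t
    using right(3)[OF that] that by (simp add: u_def)
  have neg: "u t < 0" if "T1 \<le> t" "t < \<tau>" for t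
    using left(3)[OF that] that k by (simp add: u_def mult_neg_pos)
  have zero: "u \<tau> = 0"
    by (simp add: u_def right)
  have "solves_P p q m T1 T2 a b u"
    unfolding solves_P_iff_flux[OF agree]
  proof (intro exI[of _ w] conjI ballI)
    show "(u has_real_derivative w t / P t) (at t within {T1..T2})" for t
      using du by (rule has_field_derivative_at_within)
    show "continuous_on {T1..T2} w"
      using dw by (rule continuous_on_of_DERIV)
    show "w T1 = 0" "w T2 = 0"
      using left right by (auto simp: w_def flux_init)
    fix t assume t: "t \<in> {T1<..<T2}"
    have "(if \<tau> \<le> t then (Q t - a * M t) * sol a T2 t else k * ((Q t - b * M t) * sol b T1 t))
        = Q t * u t - M t * (a * max (u t) 0 - b * max (- u t) 0)"
    proof (cases t \<tau> rule: linorder_cases)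
      case less
      then show ?thesis
        using neg[of t] t by (simp add: u_def algebra_simps)
    next
      case equal
      then show ?thesis
        using zero right by simp
    next
      case greater
      then show ?thesis
        using pos[of t] t by (simp add: u_def algebra_simps)
    qed
    then show "(w has_real_derivative Q t * u t - M t * (a * max (u t) 0 - b * max (- u t) 0)) (at t)"
      using dw[of t] by simp
  qed
  moreover have "\<exists>!t. t \<in> {T1<..<T2} \<and> u t = 0"
  proof (rule ex1I[of _ \<tau>])
    fix t assume t: "t \<in> {T1<..<T2} \<and> u t = 0"
    then show "t = \<tau>"
      using pos[of t] neg[of t] by (cases t \<tau> rule: linorder_cases) auto
  qed (use zero left right in auto)
  moreover have "0 < u T2" "\<exists>t\<in>{T1..T2}. u t \<noteq> 0"
    using pos[of T2] left right by (auto intro!: bexI[of _ T2])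
  ultimately show ?thesis
    by (auto simp: C1_gt_def)
qed

lemma C1_gt_iff:
  assumes "\<forall>t\<in>{T1..T2}. P t = p t \<and> Q t = q t \<and> M t = m t"
  shows "(a, b) \<in> C1_gt p q m T1 T2 \<longleftrightarrow>
    (\<exists>\<tau>. T1 < \<tau> \<and> \<tau> < T2 \<and> psi2 P Q M T2 a = ereal \<tau> \<and> psi1 P Q M T1 b = ereal \<tau>)"
  using C1_gt_imp_psi[OF assms] psi_imp_C1_gt[OF assms] by metis

end

section \<open>The sign symmetry and the eight quadrants\<close>

lemma solves_P_uminus:
  assumes "solves_P p q m T1 T2 a b u"
  shows "solves_P p q m T1 T2 b a (\<lambda>t. - u t)"
proof -
  obtain du where du: "\<forall>t\<in>{T1..T2}. (u has_real_derivative du t) (at t within {T1..T2})"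
    "continuous_on {T1..T2} du" "du T1 = 0" "du T2 = 0"
    and sl: "solves_SL p q (\<lambda>t x. m t * (a * max x 0 - b * max (- x) 0)) {T1<..<T2} u du"
    using assms by (auto simp: solves_P_def)
  show ?thesis
    unfolding solves_P_def
  proof (intro exI[of _ "\<lambda>t. - du t"] conjI)
    show "solves_SL p q (\<lambda>t x. m t * (b * max x 0 - a * max (- x) 0)) {T1<..<T2} (\<lambda>t. - u t) (\<lambda>t. - du t)"
      unfolding solves_SL_def
    proof (intro ballI conjI)
      fix t assume "t \<in> {T1<..<T2}"
      then have d: "(u has_real_derivative du t) (at t)" "((\<lambda>s. p s * du s) has_real_derivative
          q t * u t - m t * (a * max (u t) 0 - b * max (- u t) 0)) (at t)"
        using sl by (auto simp: solves_SL_def)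
      show "((\<lambda>t. - u t) has_real_derivative - du t) (at t)"
        using d(1) by (rule DERIV_minus)
      show "((\<lambda>s. p s * - du s) has_real_derivative
          q t * - u t - m t * (b * max (- u t) 0 - a * max (- (- u t)) 0)) (at t)"
        using DERIV_minus[OF d(2)] by (simp add: algebra_simps)
    qed
  qed (use du in \<open>auto intro: continuous_intros DERIV_minus\<close>)
qed

text \<open>Replacing \<open>u\<close> by \<open>- u\<close> interchanges positive and negative
  parts, hence \<open>a\<close> and \<open>b\<close>, and flips the sign at
  \<open>T2\<close>.\<close>

lemma C1_lt_eq: "C1_lt p q m T1 T2 = prod.swap ` C1_gt p q m T1 T2"
proof -
  have "(a, b) \<in> C1_lt p q m T1 T2 \<longleftrightarrow> (b, a) \<in> C1_gt p q m T1 T2" for a b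
  proof
    assume "(a, b) \<in> C1_lt p q m T1 T2"
    then obtain u where "solves_P p q m T1 T2 a b u" "\<exists>t\<in>{T1..T2}. u t \<noteq> 0"
      "\<exists>!t. t \<in> {T1<..<T2} \<and> u t = 0" "u T2 < 0"
      by (auto simp: C1_lt_def)
    then show "(b, a) \<in> C1_gt p q m T1 T2"
      unfolding C1_gt_def mem_Collect_eq prod.case
      by (intro exI[of _ "\<lambda>t. - u t"]) (simp add: solves_P_uminus)
  next
    assume "(b, a) \<in> C1_gt p q m T1 T2"
    then obtain u where "solves_P p q m T1 T2 b a u" "\<exists>t\<in>{T1..T2}. u t \<noteq> 0"
      "\<exists>!t. t \<in> {T1<..<T2} \<and> u t = 0" "0 < u T2"
      by (auto simp: C1_gt_def)
    then show "(a, b) \<in> C1_lt p q m T1 T2"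
      unfolding C1_lt_def mem_Collect_eq prod.case
      by (intro exI[of _ "\<lambda>t. - u t"]) (simp add: solves_P_uminus)
  qed
  then show ?thesis
    by (auto simp: set_eq_iff image_iff) (metis swap_simp)+
qed

text \<open>The signs \<open>s1\<close>, \<open>s2\<close> encode the four quadrants at once. The
  set for \<open>s2\<close> enters the alpha constant, because \<open>a\<close> has its limit at the
  end of the curve where the zero for \<open>b\<close> can go no further left; symmetrically for
  beta.\<close>

lemma (in sl_coeffs) C1_gt_quadrant_asymptotic:
  fixes T1 T2 s1 s2 :: real and p q m :: "real \<Rightarrow> real"
  assumes agree: "\<forall>t\<in>{T1..T2}. P t = p t \<and> Q t = q t \<and> M t = m t"
    and s1: "s1\<^sup>2 = 1" and s2: "s2\<^sup>2 = 1"
    and nonempty: "C1_gt p q m T1 T2 \<inter> ({x. 0 \<le> s1 * x} \<times> {y. 0 \<le> s2 * y}) \<noteq> {}"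
  shows "asymptotic_to_the_lines (C1_gt p q m T1 T2 \<inter> ({x. 0 \<le> s1 * x} \<times> {y. 0 \<le> s2 * y}))
    (is_alpha P Q M T2 {t \<in> {T1<..<T2}. 0 < s2 * m t} {x. 0 < s1 * x})
    (is_beta P Q M T1 {t \<in> {T1<..<T2}. 0 < s1 * m t} {y. 0 < s2 * y})"
    (is "asymptotic_to_the_lines ?C (is_alpha P Q M T2 ?Z2 _) (is_beta P Q M T1 ?Z1 _)")
proof -
  interpret m1: sl_coeffs P Q "\<lambda>t. s1 * M t" p1 p2 q2
    by (rule sl_coeffs_scale)
  interpret m2: sl_coeffs P Q "\<lambda>t. s2 * M t" p1 p2 q2
    by (rule sl_coeffs_scale)
  have s_self: "s1 * (s1 * x) = x" "s2 * (s2 * x) = x" for x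
    using s1 s2 by (simp_all add: power2_eq_square flip: mult.assoc)
  \<comment> \<open>\<open>A\<close> and \<open>B\<close> relate a zero to the modulus of the
    weight, so that strict monotonicity for positive weights applies in every quadrant.\<close>
  define A where "A \<tau> a \<longleftrightarrow> 0 < a \<and> psi2 P Q M T2 (s1 * a) = ereal \<tau>" for \<tau> a
  define B where "B \<tau> b \<longleftrightarrow> 0 < b \<and> psi1 P Q M T1 (s2 * b) = ereal \<tau>" for \<tau> b
  have A1: "A \<tau> a \<longleftrightarrow> 0 < a \<and> psi2 P Q (\<lambda>t. s1 * M t) T2 a = ereal \<tau>" for \<tau> a
    by (simp add: A_def psi2_scale mult.commute)
  have B1: "B \<tau> b \<longleftrightarrow> 0 < b \<and> psi1 P Q (\<lambda>t. s2 * M t) T1 b = ereal \<tau>" for \<tau> b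
    by (simp add: B_def psi1_scale mult.commute)
  have M_eq: "M t = m t" if "t \<in> {T1<..<T2}" for t
    using agree that by auto
  \<comment> \<open>With \<open>T1 \<le> \<tau>\<close> the point of positive weight lies in the
    open interval, where \<open>M\<close> equals \<open>m\<close>; the extension has no
    influence.\<close>
  have A_Z1: "\<exists>t\<in>?Z1. \<tau> < t" if "A \<tau> a" "T1 \<le> \<tau>" for \<tau> a
  proof -
    have "psi2 P Q (\<lambda>t. s1 * M t) T2 a = ereal \<tau>"
      using that(1) by (simp add: A1)
    then obtain t where t: "\<tau> < t" "t < T2" "0 < a * (s1 * M t)"
      by (rule m1.psi2_weight_positive_somewhere)
    moreover have "0 < a"
      using that(1) by (simp add: A_def)
    ultimately have "t \<in> ?Z1"
      using that(2) M_eq[of t] by (auto simp: zero_less_mult_iff)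
    then show ?thesis
      using t by blast
  qed
  have B_Z2: "\<exists>t\<in>?Z2. t < \<tau>" if "B \<tau> b" "\<tau> \<le> T2" for \<tau> b
  proof -
    have "psi1 P Q (\<lambda>t. s2 * M t) T1 b = ereal \<tau>"
      using that(1) by (simp add: B1)
    then obtain t where t: "T1 < t" "t < \<tau>" "0 < b * (s2 * M t)"
      by (rule m2.psi1_weight_positive_somewhere)
    moreover have "0 < b"
      using that(1) by (simp add: B_def)
    ultimately have "t \<in> ?Z2"
      using that(2) M_eq[of t] by (auto simp: zero_less_mult_iff)
    then show ?thesis
      using t by blast
  qed
  define i where "i = Inf ?Z2"
  define j where "j = Sup ?Z1"
  have bdd: "bdd_below ?Z2" "bdd_above ?Z1"
    by (auto intro: bdd_belowI[of _ T1] bdd_aboveI[of _ T2])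
  have A_less': "\<tau> < j" if "A \<tau> a" "T1 \<le> \<tau>" for \<tau> a
    using A_Z1[OF that] cSup_upper[OF _ bdd(2)] unfolding j_def by fastforce
  have B_less': "i < \<tau>" if "B \<tau> b" "\<tau> \<le> T2" for \<tau> b
    using B_Z2[OF that] cInf_lower[OF _ bdd(1)] unfolding i_def by fastforce
  have C_iff: "(x, y) \<in> ?C \<longleftrightarrow>
      (\<exists>\<tau>. T1 < \<tau> \<and> \<tau> < T2 \<and> A \<tau> (s1 * x) \<and> B \<tau> (s2 * y))" for x y
  proof
    assume xy: "(x, y) \<in> ?C"
    then obtain \<tau> where \<tau>: "T1 < \<tau>" "\<tau> < T2" "psi2 P Q M T2 x = ereal \<tau>" "psi1 P Q M T1 y = ereal \<tau>"
      using C1_gt_iff[OF agree] by auto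
    \<comment> \<open>The curve avoids the axes, so closed and open quadrants cut out the same
      set.\<close>
    have "x \<noteq> 0" "y \<noteq> 0"
      using psi2_weight_positive_somewhere[OF \<tau>(3)] psi1_weight_positive_somewhere[OF \<tau>(4)]
      by (metis less_irrefl mult_zero_left)+
    then have "0 < s1 * x" "0 < s2 * y"
      using xy s1 s2 by (auto simp: less_le)
    then show "\<exists>\<tau>. T1 < \<tau> \<and> \<tau> < T2 \<and> A \<tau> (s1 * x) \<and> B \<tau> (s2 * y)"
      using \<tau> by (auto simp: A_def B_def s_self)
  next
    assume "\<exists>\<tau>. T1 < \<tau> \<and> \<tau> < T2 \<and> A \<tau> (s1 * x) \<and> B \<tau> (s2 * y)"
    then show "(x, y) \<in> ?C"
      using C1_gt_iff[OF agree] by (auto simp: A_def B_def s_self)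
  qed
  obtain \<tau>0 a0 b0 where 0: "T1 < \<tau>0" "\<tau>0 < T2" "A \<tau>0 a0" "B \<tau>0 b0"
    using nonempty C_iff by (metis ex_in_conv surj_pair)
  have Z: "?Z1 \<noteq> {}" "?Z2 \<noteq> {}"
    using A_Z1[OF 0(3)] B_Z2[OF 0(4)] 0 by auto
  have "T1 \<le> i" "j \<le> T2"
    unfolding i_def j_def by (intro cInf_greatest cSup_least Z; auto)+
  have "i < j"
    using A_less'[OF 0(3)] B_less'[OF 0(4)] 0 by simp
  have A_fun: "\<tau> = \<tau>'" if "A \<tau> a" "A \<tau>' a" for \<tau> \<tau>' a
    using that by (simp add: A_def)
  have B_fun: "\<tau> = \<tau>'" if "B \<tau> b" "B \<tau>' b" for \<tau> \<tau>' b
    using that by (simp add: B_def)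
  have A_mono: "\<exists>\<tau>'>\<tau>. A \<tau>' a'" if "A \<tau> a" "a < a'" for \<tau> a a'
    using that m1.psi2_strict_mono[of a a'] unfolding A1 by (metis less_trans)
  have B_mono: "\<exists>\<tau>'<\<tau>. B \<tau>' b'" if "B \<tau> b" "b < b'" for \<tau> b b'
    using that m2.psi1_strict_mono[of b b'] unfolding B1 by (metis less_trans)
  have A_surj: "\<exists>a. A \<tau> a" if "i \<le> \<tau>" "\<tau> < j" for \<tau>
  proof -
    obtain x where "x \<in> ?Z1" "\<tau> < x"
      using \<open>\<tau> < j\<close> less_cSup_iff[OF Z(1) bdd(2)] unfolding j_def by blast
    then have "\<tau> < x" "x < T2" "0 < s1 * M x"
      using M_eq[of x] by auto
    then show ?thesis
      using m1.psi2_surj[of \<tau> T2 x] unfolding A1 by (metis less_trans)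
  qed
  have B_surj: "\<exists>b. B \<tau> b" if "i < \<tau>" "\<tau> \<le> j" for \<tau>
  proof -
    obtain x where "x \<in> ?Z2" "x < \<tau>"
      using \<open>i < \<tau>\<close> cInf_less_iff[OF Z(2) bdd(1)] unfolding i_def by blast
    then have "x < \<tau>" "T1 < x" "0 < s2 * M x"
      using M_eq[of x] by auto
    then show ?thesis
      using m2.psi1_surj[of T1 \<tau> x] unfolding B1 by (metis less_trans)
  qed
  have A_less: "\<tau> < j" if "i \<le> \<tau>" "A \<tau> a" for \<tau> a
    using A_less'[OF that(2)] that(1) \<open>T1 \<le> i\<close> by simp
  have B_less: "i < \<tau>" if "\<tau> \<le> j" "B \<tau> b" for \<tau> b
    using B_less'[OF that(2)] that(1) \<open>j \<le> T2\<close> by simp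
  have A_pos: "0 < a" if "A \<tau> a" for \<tau> a
    using that by (simp add: A_def)
  have B_pos: "0 < b" if "B \<tau> b" for \<tau> b
    using that by (simp add: B_def)
  \<comment> \<open>Since \<open>i < j\<close>, the end \<open>i\<close> lies in the range for
    \<open>A\<close> and the end \<open>j\<close> in that for \<open>B\<close>. \<open>A\<close> has
    no weight at \<open>j\<close> and \<open>B\<close> none at \<open>i\<close>; there the weights
    blow up.\<close>
  obtain \<alpha> \<beta> where ends: "A i \<alpha>" "B j \<beta>"
    using A_surj[of i] B_surj[of j] \<open>i < j\<close> by auto
  have abs_s: "\<bar>s1\<bar> = 1" "\<bar>s2\<bar> = 1"
    using s1 s2 by (auto simp: power2_eq_1_iff)
  have C_eq: "?C = {(s1 * a, s2 * b) | \<tau> a b. i < \<tau> \<and> \<tau> < j \<and> A \<tau> a \<and> B \<tau> b}"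
  proof (intro set_eqI iffI)
    fix z assume "z \<in> ?C"
    then obtain x y \<tau> where z: "z = (x, y)" and \<tau>: "T1 < \<tau>" "\<tau> < T2" "A \<tau> (s1 * x)" "B \<tau> (s2 * y)"
      using C_iff by (metis surj_pair)
    then show "z \<in> {(s1 * a, s2 * b) | \<tau> a b. i < \<tau> \<and> \<tau> < j \<and> A \<tau> a \<and> B \<tau> b}"
      using A_less'[OF \<tau>(3)] B_less'[OF \<tau>(4)]
      by (intro CollectI exI[of _ \<tau>] exI[of _ "s1 * x"] exI[of _ "s2 * y"]) (simp add: s_self)
  next
    fix z assume "z \<in> {(s1 * a, s2 * b) | \<tau> a b. i < \<tau> \<and> \<tau> < j \<and> A \<tau> a \<and> B \<tau> b}"
    then obtain \<tau> a b where z: "z = (s1 * a, s2 * b)" "i < \<tau>" "\<tau> < j" "A \<tau> a" "B \<tau> b"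
      by blast
    have "T1 < \<tau>" "\<tau> < T2"
      using z \<open>T1 \<le> i\<close> \<open>j \<le> T2\<close> by auto
    then show "z \<in> ?C"
      unfolding z(1) C_iff s_self using z by blast
  qed
  have "asymptotic_to_lines ?C (s1 * \<alpha>) (s2 * \<beta>)"
    unfolding C_eq
    by (rule monotone_curve_asymptotic[where A = A and B = B, OF A_fun A_mono A_surj A_less A_pos
          B_fun B_mono B_surj B_less B_pos ends abs_s]; assumption)
  moreover have "is_alpha P Q M T2 ?Z2 {x. 0 < s1 * x} x \<longleftrightarrow> A i (s1 * x)" for x
    using Z by (simp add: is_alpha_def A_def s_self i_def)
  moreover have "is_beta P Q M T1 ?Z1 {y. 0 < s2 * y} y \<longleftrightarrow> B j (s2 * y)" for y
    using Z by (simp add: is_beta_def B_def s_self j_def)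
  moreover have "x = s1 * \<alpha>" if "A i (s1 * x)" for x
  proof -
    \<comment> \<open>Two different moduli with the same zero would, by strict monotonicity, give
      two zeros for one weight.\<close>
    have "s1 * x = \<alpha>"
      using A_mono[OF that] A_mono[OF ends(1)] A_fun[OF that] A_fun[OF ends(1)]
      by (metis less_irrefl linorder_neqE_linordered_idom)
    then show ?thesis
      using s_self(1)[of x] by simp
  qed
  moreover have "y = s2 * \<beta>" if "B j (s2 * y)" for y
  proof -
    have "s2 * y = \<beta>"
      using B_mono[OF that] B_mono[OF ends(2)] B_fun[OF that] B_fun[OF ends(2)]
      by (metis less_irrefl linorder_neqE_linordered_idom)
    then show ?thesis
      using s_self(2)[of y] by simp
  qed
  ultimately show ?thesis
    using ends by (intro asymptotic_to_the_linesI[of _ "s1 * \<alpha>" _ "s2 * \<beta>"]) (simp_all add: s_self)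
qed

theorem theorem7:
  fixes T1 T2 :: real and p q m :: "real \<Rightarrow> real"
    and P Q M :: "real \<Rightarrow> real" and p1 p2 q2 :: real
  assumes "T1 < T2"
    and "continuous_on {T1..T2} p" and "continuous_on {T1..T2} q" and "continuous_on {T1..T2} m"
    and "\<forall>t\<in>{T1..T2}. p t > 0" and "\<forall>t\<in>{T1..T2}. q t \<ge> 0"
    and "\<exists>t\<in>{T1..T2}. m t \<noteq> 0"
    and "continuous_on UNIV P" and "continuous_on UNIV Q" and "continuous_on UNIV M"
    and "\<forall>t\<in>{T1..T2}. P t = p t \<and> Q t = q t \<and> M t = m t"
    and "p1 > 0" and "\<forall>t. p1 \<le> P t \<and> P t \<le> p2" and "\<forall>t. 0 \<le> Q t \<and> Q t \<le> q2"
  shows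
    "(C1_gt p q m T1 T2 \<inter> ({0..} \<times> {0..}) \<noteq> {} \<longrightarrow>
        asymptotic_to_the_lines (C1_gt p q m T1 T2 \<inter> ({0..} \<times> {0..}))
          (is_alpha P Q M T2 (pos_set m T1 T2) {0<..})
          (is_beta P Q M T1 (pos_set m T1 T2) {0<..})) \<and>
     (C1_gt p q m T1 T2 \<inter> ({..0} \<times> {..0}) \<noteq> {} \<longrightarrow>
        asymptotic_to_the_lines (C1_gt p q m T1 T2 \<inter> ({..0} \<times> {..0}))
          (is_alpha P Q M T2 (neg_set m T1 T2) {..<0})
          (is_beta P Q M T1 (neg_set m T1 T2) {..<0})) \<and>
     (C1_gt p q m T1 T2 \<inter> ({0..} \<times> {..0}) \<noteq> {} \<longrightarrow>
        asymptotic_to_the_lines (C1_gt p q m T1 T2 \<inter> ({0..} \<times> {..0}))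
          (is_alpha P Q M T2 (neg_set m T1 T2) {0<..})
          (is_beta P Q M T1 (pos_set m T1 T2) {..<0})) \<and>
     (C1_gt p q m T1 T2 \<inter> ({..0} \<times> {0..}) \<noteq> {} \<longrightarrow>
        asymptotic_to_the_lines (C1_gt p q m T1 T2 \<inter> ({..0} \<times> {0..}))
          (is_alpha P Q M T2 (pos_set m T1 T2) {..<0})
          (is_beta P Q M T1 (neg_set m T1 T2) {0<..})) \<and>
     (C1_lt p q m T1 T2 \<inter> ({0..} \<times> {0..}) \<noteq> {} \<longrightarrow>
        asymptotic_to_the_lines (C1_lt p q m T1 T2 \<inter> ({0..} \<times> {0..}))
          (is_beta P Q M T1 (pos_set m T1 T2) {0<..})
          (is_alpha P Q M T2 (pos_set m T1 T2) {0<..})) \<and>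
     (C1_lt p q m T1 T2 \<inter> ({..0} \<times> {..0}) \<noteq> {} \<longrightarrow>
        asymptotic_to_the_lines (C1_lt p q m T1 T2 \<inter> ({..0} \<times> {..0}))
          (is_beta P Q M T1 (neg_set m T1 T2) {..<0})
          (is_alpha P Q M T2 (neg_set m T1 T2) {..<0})) \<and>
     (C1_lt p q m T1 T2 \<inter> ({0..} \<times> {..0}) \<noteq> {} \<longrightarrow>
        asymptotic_to_the_lines (C1_lt p q m T1 T2 \<inter> ({0..} \<times> {..0}))
          (is_beta P Q M T1 (neg_set m T1 T2) {0<..})
          (is_alpha P Q M T2 (pos_set m T1 T2) {..<0})) \<and>
     (C1_lt p q m T1 T2 \<inter> ({..0} \<times> {0..}) \<noteq> {} \<longrightarrow>
        asymptotic_to_the_lines (C1_lt p q m T1 T2 \<inter> ({..0} \<times> {0..}))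
          (is_beta P Q M T1 (pos_set m T1 T2) {..<0})
          (is_alpha P Q M T2 (neg_set m T1 T2) {0<..}))"
proof -
  interpret sl_coeffs P Q M p1 p2 q2
    using assms by unfold_locales auto
  have half_lines: "{x :: real. 0 \<le> 1 * x} = {0..}" "{x :: real. 0 \<le> - 1 * x} = {..0}"
    "{x :: real. 0 < 1 * x} = {0<..}" "{x :: real. 0 < - 1 * x} = {..<0}"
    by auto
  have weight_sets: "{t \<in> {T1<..<T2}. 0 < 1 * m t} = pos_set m T1 T2"
    "{t \<in> {T1<..<T2}. 0 < - 1 * m t} = neg_set m T1 T2"
    by (auto simp: pos_set_def neg_set_def)
  \<comment> \<open>The two mixed quadrants trade places under the swap, so the one with signs
    \<open>+\<close>, \<open>-\<close> for \<open>C1_lt\<close> comes from the one with signs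
    \<open>-\<close>, \<open>+\<close> for \<open>C1_gt\<close>, and conversely.\<close>
  have swap: "C1_lt p q m T1 T2 \<inter> (X \<times> Y) = prod.swap ` (C1_gt p q m T1 T2 \<inter> (Y \<times> X))" for X Y
    unfolding C1_lt_eq by auto
  note quadrant = C1_gt_quadrant_asymptotic[OF assms(11)]
  note gt = quadrant[of 1 1, unfolded half_lines weight_sets]
    quadrant[of "- 1" "- 1", unfolded half_lines weight_sets]
    quadrant[of 1 "- 1", unfolded half_lines weight_sets]
    quadrant[of "- 1" 1, unfolded half_lines weight_sets]
  note lt = gt[THEN asymptotic_to_the_lines_swap]
  show ?thesis
    unfolding swap image_is_empty by (intro conjI impI gt lt; simp)
qed

end
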